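(* Let $p$ be a prime and $k\ge1$. Every $k$-tuple $\mathbb Y=(Y^1,\dots,Y^k)$ of Young diagrams includes a $k$-tuple $\mathbb Z=(Z^1,\dots,Z^k)$ of Young diagrams (i.e. $Z^l\subseteq Y^l$ for all $l$) with $|Z^1|+\cdots+|Z^k|=\psi_p(\mathbb Y)$ such that $f^{\mathbb Z}$ is prime to $p$.
   Context: A partition is a weakly decreasing tuple $(\lambda^1,\dots,\lambda^m)$ of positive integers (the empty tuple allowed); its Young diagram is $\{(i,j):1\le i\le m,\ 1\le j\le\lambda^i\}$, identified with the partition; $|Y|$ is its number of cells. For a cell $(i,j)\in Y$, the hook $H_{i,j}(Y)=\{(i',j')\in Y:(i'\ge i,\ j'=j)\text{ or }(i'=i,\ j'\ge j)\}$ and its hook length is $|H_{i,j}(Y)|$. For a $k$-tuple $\mathbb Y$, $\mathcal H(\mathbb Y)$ is the multiset union of the multisets of hook lengths of all cells of $Y^1,\dots,Y^k$. For an integer $h\ge1$, $\pi_p(h)=\sum_{L=0}^{\operatorname{ord}_p(h)}p^L$, where $\operatorname{ord}_p$ is the $p$-adic order. $\psi_p(\mathbb Y)=\bigoplus_{p,\ h\in\mathcal H(\mathbb Y)}\pi_p(h)$, the $p$-Nim-sum (base-$p$ digitwise addition modulo $p$, without carrying) of $\pi_p(h)$ over all $h$ in $\mathcal H(\mathbb Y)$ with multiplicity (equal to $0$ for the empty multiset). A standard tableau of shape $\mathbb Y$ is a bijection $T$ from the disjoint union $Y^1\sqcup\cdots\sqcup Y^k$ to $\{1,\dots,|Y^1|+\cdots+|Y^k|\}$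 such that $T(i,j)\le T(i',j')$ whenever $(i,j),(i',j')$ lie in the same $Y^l$ with $i\le i'$ and $j\le j'$; $f^{\mathbb Y}$ is the number of standard tableaux of shape $\mathbb Y$. *)

theory Defs
  imports "HOL-Library.FuncSet" "HOL-Library.Multiset" "HOL-Computational_Algebra.Primes"
begin

definition is_partition :: "nat list \<Rightarrow> bool" where
  "is_partition lam \<longleftrightarrow> sorted_wrt (\<ge>) lam \<and> (\<forall>a\<in>set lam. 0 < a)"

text \<open>Cells are numbered from 1 while lists are indexed from 0, hence the shift by one.\<close>

definition diagram_of :: "nat list \<Rightarrow> (nat \<times> nat) set" where
  "diagram_of lam = {(i, j). 1 \<le> i \<and> i \<le> length lam \<and> 1 \<le> j \<and> j \<le> lam ! (i - 1)}"

definition young_diagram :: "(nat \<times> nat) set \<Rightarrow> bool" where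
  "young_diagram Y \<longleftrightarrow> (\<exists>lam. is_partition lam \<and> Y = diagram_of lam)"

definition young_tuple :: "nat \<Rightarrow> (nat \<times> nat) set list \<Rightarrow> bool" where
  "young_tuple k Ys \<longleftrightarrow> length Ys = k \<and> (\<forall>Y\<in>set Ys. young_diagram Y)"

definition tuple_size :: "(nat \<times> nat) set list \<Rightarrow> nat" where
  "tuple_size Ys = (\<Sum>Y\<leftarrow>Ys. card Y)"

definition hook :: "(nat \<times> nat) set \<Rightarrow> nat \<times> nat \<Rightarrow> (nat \<times> nat) set" where
  "hook Y = (\<lambda>(i, j). {(i', j') \<in> Y. (i' \<ge> i \<and> j' = j) \<or> (i' = i \<and> j' \<ge> j)})"

definition hook_lengths :: "(nat \<times> nat) set list \<Rightarrow> nat multiset" where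
  "hook_lengths Ys = (\<Sum>Y\<leftarrow>Ys. image_mset (\<lambda>c. card (hook Y c)) (mset_set Y))"

definition digit :: "nat \<Rightarrow> nat \<Rightarrow> nat \<Rightarrow> nat" where
  "digit p n L = n div p ^ L mod p"

text \<open>
  The sum ranges over the finitely many positions \<open>L\<close> up to the leading base-\<open>p\<close> digit of the
  largest summand; all other digits vanish (see \<open>digit_nim_sum\<close> below).
\<close>

definition nim_sum :: "nat \<Rightarrow> nat multiset \<Rightarrow> nat" where
  "nim_sum p M = (\<Sum>L | \<exists>n\<in>#M. p ^ L \<le> n. ((\<Sum>n\<in>#M. digit p n L) mod p) * p ^ L)"

definition pi_nim :: "nat \<Rightarrow> nat \<Rightarrow> nat" where
  "pi_nim p h = (\<Sum>L = 0..multiplicity p h. p ^ L)"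

definition psi_nim :: "nat \<Rightarrow> (nat \<times> nat) set list \<Rightarrow> nat" where
  "psi_nim p Ys = nim_sum p (image_mset (pi_nim p) (hook_lengths Ys))"

text \<open>The disjoint union of the components: \<open>(l, i, j)\<close> is the cell \<open>(i, j)\<close> of component \<open>l\<close>.\<close>

definition tuple_cells :: "(nat \<times> nat) set list \<Rightarrow> (nat \<times> nat \<times> nat) set" where
  "tuple_cells Ys = (SIGMA l:{..<length Ys}. Ys ! l)"

text \<open>
  Tableaux are functions on the cells only; requiring them to be extensional (a fixed value
  off the cells) makes it meaningful to count them.
\<close>

definition standard_tableaux ::
    "(nat \<times> nat) set list \<Rightarrow> (nat \<times> nat \<times> nat \<Rightarrow> nat) set" where
  "standard_tableaux Ys =
    {T \<in> extensional (tuple_cells Ys).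
       bij_betw T (tuple_cells Ys) {1..tuple_size Ys} \<and>
       (\<forall>l i j i' j'. (l, i, j) \<in> tuple_cells Ys \<and> (l, i', j') \<in> tuple_cells Ys \<and>
          i \<le> i' \<and> j \<le> j' \<longrightarrow> T (l, i, j) \<le> T (l, i', j'))}"

definition num_standard_tableaux :: "(nat \<times> nat) set list \<Rightarrow> nat" where
  "num_standard_tableaux Ys = card (standard_tableaux Ys)"

lemma digit_sum:
  assumes p: "2 \<le> p" and d: "\<And>L. d L < p"
  shows "(\<Sum>L<m. d L * p ^ L) < p ^ m \<and>
    digit p (\<Sum>L<m. d L * p ^ L) K = (if K < m then d K else 0)"
proof (induction m arbitrary: K)
  case 0
  then show ?case by (simp add: digit_def)
next
  case (Suc m)
  let ?s = "\<Sum>L<m. d L * p ^ L"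
  have s: "?s < p ^ m" using Suc.IH by blast
  have "(d m + 1) * p ^ m \<le> p * p ^ m"
    by (rule mult_right_mono) (use d[of m] in auto)
  then have less: "?s + d m * p ^ m < p ^ Suc m" using s by (simp add: algebra_simps)
  have "digit p (?s + d m * p ^ m) K = (if K < Suc m then d K else 0)"
  proof (cases K m rule: linorder_cases)
    case less
    then have "m = (m - Suc K) + 1 + K" by simp
    then have "p ^ m = p ^ (m - Suc K) * p * p ^ K"
      by (metis power_add power_one_right)
    then have "?s + d m * p ^ m = ?s + (d m * p ^ (m - Suc K) * p) * p ^ K"
      by (simp only: mult.assoc)
    then have "(?s + d m * p ^ m) div p ^ K = d m * p ^ (m - Suc K) * p + ?s div p ^ K"
      using p by (simp only: div_mult_self1) simp
    then have "digit p (?s + d m * p ^ m) K = digit p ?s K"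
      by (simp add: digit_def)
    then show ?thesis using Suc.IH[of K] less by simp
  next
    case equal
    then show ?thesis using s d[of m] p by (simp add: digit_def)
  next
    case greater
    then have "p ^ Suc m \<le> p ^ K" using p by (intro power_increasing) auto
    then show ?thesis using less greater by (simp add: digit_def)
  qed
  then show ?case using less by simp
qed

lemma digit_nim_sum:
  assumes p: "2 \<le> p"
  shows "digit p (nim_sum p M) L = (\<Sum>n\<in>#M. digit p n L) mod p"
proof -
  let ?A = "{L. \<exists>n\<in>#M. p ^ L \<le> n}"
  have "L < sum_mset M" if L: "L \<in> ?A" for L
  proof -
    obtain n where n: "n \<in># M" "p ^ L \<le> n" using L by blast
    have "L < p ^ L" using p by (intro less_exp[THEN less_le_trans] power_mono) auto
    also have "p ^ L \<le> sum_mset M" using n by (metis le_trans sum_mset.remove le_add1)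
    finally show ?thesis .
  qed
  then have fin: "finite ?A" by (metis finite_nat_set_iff_bounded)
  have down: "K \<in> ?A" if "L \<in> ?A" "K \<le> L" for K L
  proof -
    have "p ^ K \<le> p ^ L" using that(2) p by (intro power_increasing) auto
    then show ?thesis using that(1) by (auto intro: order_trans)
  qed
  have "\<exists>m. ?A = {..<m}"
  proof (cases "?A = {}")
    case True
    then show ?thesis by (metis lessThan_0)
  next
    case False
    have "?A = {..<Suc (Max ?A)}"
    proof
      show "?A \<subseteq> {..<Suc (Max ?A)}"
        using Max_ge[OF fin] by (meson lessThan_iff less_Suc_eq_le subsetI)
      show "{..<Suc (Max ?A)} \<subseteq> ?A"
        using down[OF Max_in[OF fin False]] by (meson lessThan_iff less_Suc_eq_le subsetI)
    qed
    then show ?thesis by (rule exI)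
  qed
  then obtain m where A: "?A = {..<m}" by (rule exE)
  have zero: "(\<Sum>n\<in>#M. digit p n L) mod p = 0" if "\<not> L < m"
  proof -
    have "L \<notin> ?A" using that A by simp
    then have "digit p n L = 0" if "n \<in># M" for n using that by (auto simp: digit_def)
    then have "(\<Sum>n\<in>#M. digit p n L) = 0" by (intro sum_mset.neutral) auto
    then show ?thesis by (simp only: mod_0)
  qed
  show ?thesis
    using digit_sum[OF p, of "\<lambda>L. (\<Sum>n\<in>#M. digit p n L) mod p" m L] p
    unfolding nim_sum_def A by (cases "L < m") (use zero in auto)
qed

end

(*
  Let w_L be the number of hook lengths of the tuple divisible by p^L. By the hook length formula,
  the p-adic valuation of f is the sum over L >= 1 of floor(N / p^L) - w_L, where N is the number
  of cells, so f is prime to p iff w_L = floor(N / p^L) for all L. On the other hand digit L of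
  psi_p is w_L mod p, which equals c_L mod p for c_L = w_L - p w_{L+1} >= 0. Hence f is prime to p
  as soon as all c_L are less than p.

  Encode diagrams by beta-sets. If c_j >= p, then for some runner modulo p^{j+1} one can lower by
  p^j as many beads as it has in excess over the preceding runner. Choosing these beads by the
  pigeonhole principle along the tree of residue classes modulo p^{j+2}, p^{j+3}, ... decreases no
  w_L with L > j; this leaves c_L unchanged for L /= j and lowers c_j, but not below p - 1.
  Doing this for j from the top down to 0 yields a subtuple with N >= psi_p and f prime to p.
  Since f is the sum of the numbers f over all ways to remove a corner, corners can then be removed
  one at a time, keeping f prime to p, until N = psi_p.
*)

theory Submission
  imports Defs Complex_Main
begin

text \<open>Lowering a single bead by \<open>p ^ j\<close> may raise or lower the weights at the
  levels above \<open>j\<close>; this is why a set of beads of one runner is lowered at once.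
  Lowering s well chosen beads of a runner with excess a raises w_(j+1) by s (a - s). At s = a this
  vanishes, so c_j drops by exactly a; for 0 < s < a it is positive, and the inequality p w_(j+1) <=
  w_j, valid for every bead set, then bounds a by c_j - (p - 1). The order of the levels matters. If
  c_L < p, then w_(L+1) = floor(w_L / p) is the largest value that w_L permits. Hence, once all c_L
  with L > j are below p, the weights above level j cannot change if none of them decreases, given
  that w_(j+1) stays the same. The number of cells is N = sum of c_L p^L. Replacing c_L by min(c_L,
  p - 1) never goes below c_L mod p, which is digit L of psi_p; so the reduced tuple still has at
  least psi_p cells.\<close>

section \<open>The abacus\<close>

text \<open>A finite set \<open>U\<close> of beads (beta-numbers) encodes a Young diagram; the pair \<open>(u, t)\<close> of a bead
  and a gap below it corresponds to a cell with hook length \<open>u - t\<close>.\<close>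

definition bead_gaps :: "nat set \<Rightarrow> (nat \<times> nat) set" where
  "bead_gaps U = {(u, t). u \<in> U \<and> t < u \<and> t \<notin> U}"

definition weight :: "nat \<Rightarrow> nat set \<Rightarrow> nat" where
  "weight m U = card {(u, t) \<in> bead_gaps U. m dvd (u - t)}"

text \<open>The counterpart of the pairs counted by \<open>weight\<close>: both kinds together are
  easy to count, and the number of pairs of congruent beads depends only on the sizes of the residue
  classes.\<close>

definition bead_pairs :: "nat \<Rightarrow> nat set \<Rightarrow> (nat \<times> nat) set" where
  "bead_pairs m U = {(u, t). u \<in> U \<and> t \<in> U \<and> t < u \<and> m dvd (u - t)}"

text \<open>For a bead set this is one runner of the abacus with \<open>m\<close> runners.\<close>

definition cls :: "nat \<Rightarrow> nat \<Rightarrow> nat set \<Rightarrow> nat set" where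
  "cls m c U = {x \<in> U. x mod m = c mod m}"

text \<open>The positions from which a bead cannot be lowered by \<open>q\<close>. This is the bead
  set shifted up by \<open>q\<close>, with all negative positions regarded as occupied; its class of
  \<open>x\<close> therefore represents the runner preceding that of \<open>x\<close>, ready for
  comparison with \<open>cls m x U\<close>.\<close>

definition blocked :: "nat \<Rightarrow> nat set \<Rightarrow> nat set" where
  "blocked q U = {x. x < q \<or> x - q \<in> U}"

text \<open>For bead sets of equal size this is inclusion of the encoded diagrams.\<close>

definition dominated :: "nat set \<Rightarrow> nat set \<Rightarrow> bool" where
  "dominated V U \<longleftrightarrow> finite V \<and> finite U \<and> card V = card U \<and>
     (\<forall>t. card {x \<in> V. t \<le> x} \<le> card {x \<in> U. t \<le> x})"

lemma dominated_refl: "finite U \<Longrightarrow> dominated U U"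
  by (simp add: dominated_def)

lemma dominated_trans: "dominated W V \<Longrightarrow> dominated V U \<Longrightarrow> dominated W U"
proof -
  assume a: "dominated W V" "dominated V U"
  have "card {x \<in> W. t \<le> x} \<le> card {x \<in> U. t \<le> x}" for t
  proof -
    have "card {x \<in> W. t \<le> x} \<le> card {x \<in> V. t \<le> x}"
      and "card {x \<in> V. t \<le> x} \<le> card {x \<in> U. t \<le> x}"
      using a by (simp_all add: dominated_def)
    then show ?thesis by (rule le_trans)
  qed
  then show ?thesis using a by (simp add: dominated_def)
qed

lemma finite_cls [simp]: "finite U \<Longrightarrow> finite (cls m c U)"
  by (simp add: cls_def)

lemma finite_blocked [simp]: "finite U \<Longrightarrow> finite (blocked q U)"
proof -
  assume "finite U"
  moreover have "blocked q U \<subseteq> {..<q} \<union> (\<lambda>x. x + q) ` U"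
    by (force simp: blocked_def image_iff)
  ultimately show ?thesis by (meson finite_UnI finite_imageI finite_lessThan finite_subset)
qed

lemma finite_bead_gaps [simp]: "finite U \<Longrightarrow> finite (bead_gaps U)"
proof -
  assume fin: "finite U"
  have "bead_gaps U \<subseteq> (SIGMA u:U. {..<u})" by (auto simp: bead_gaps_def)
  with fin show ?thesis by (meson finite_SigmaI finite_lessThan finite_subset)
qed

lemma finite_bead_pairs [simp]: "finite U \<Longrightarrow> finite (bead_pairs m U)"
  by (rule finite_subset[of _ "U \<times> U"]) (auto simp: bead_pairs_def)

section \<open>Hooks counted through pairs of congruent beads\<close>

lemma card_multiples_below:
  fixes m u :: nat assumes "0 < m"
  shows "card {t. t < u \<and> m dvd (u - t)} = u div m"
proof -
  have "bij_betw (\<lambda>i. u - m * i) {1..u div m} {t. t < u \<and> m dvd (u - t)}"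
  proof (rule bij_betw_imageI)
    have le: "m * i \<le> u" if "i \<le> u div m" for i
      using that assms by (metis less_eq_div_iff_mult_less_eq mult.commute)
    show "inj_on (\<lambda>i. u - m * i) {1..u div m}"
    proof (rule inj_onI)
      fix i j assume "i \<in> {1..u div m}" "j \<in> {1..u div m}" "u - m * i = u - m * j"
      moreover from this have "m * i \<le> u" "m * j \<le> u" using le[of i] le[of j] by auto
      ultimately have "m * i = m * j" by (metis diff_diff_cancel)
      then show "i = j" using assms by simp
    qed
    show "(\<lambda>i. u - m * i) ` {1..u div m} = {t. t < u \<and> m dvd (u - t)}"
    proof (intro equalityI subsetI)
      fix t assume "t \<in> (\<lambda>i. u - m * i) ` {1..u div m}"
      then obtain i where i: "1 \<le> i" "i \<le> u div m" "t = u - m * i" by auto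
      have "0 < m * i" using i assms by simp
      then have "0 < u" "0 < m * i" using le[OF i(2)] by linarith+
      then have "t < u" unfolding i(3) by (simp only: diff_less)
      then show "t \<in> {t. t < u \<and> m dvd (u - t)}" using le[OF i(2)] i(3) by simp
    next
      fix t assume "t \<in> {t. t < u \<and> m dvd (u - t)}"
      then obtain i where i: "t < u" "u - t = m * i" by auto
      then have "t = u - m * i" "1 \<le> i" by (cases i; auto)+
      moreover have "i \<le> u div m"
        using i assms by (metis diff_le_self div_le_mono nonzero_mult_div_cancel_left not_gr_zero)
      ultimately show "t \<in> (\<lambda>i. u - m * i) ` {1..u div m}" by auto
    qed
  qed
  from bij_betw_same_card[OF this] show ?thesis by simp
qed

text \<open>A bead \<open>u\<close> has \<open>u div m\<close> positions below it in its own class,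
  and each of them is a gap or a bead. The weight is thus determined by the quotients of the beads
  and the sizes of the classes.\<close>

lemma weight_plus_pairs:
  assumes "finite U" "0 < m"
  shows "weight m U + card (bead_pairs m U) = (\<Sum>u\<in>U. u div m)"
proof -
  let ?G = "{(u, t) \<in> bead_gaps U. m dvd (u - t)}"
  have "?G \<inter> bead_pairs m U = {}" by (auto simp: bead_gaps_def bead_pairs_def)
  moreover have "finite ?G"
    by (rule finite_subset[OF _ finite_bead_gaps[OF assms(1)]]) auto
  ultimately have "weight m U + card (bead_pairs m U) = card (?G \<union> bead_pairs m U)"
    using assms by (simp add: weight_def card_Un_disjoint)
  also have "?G \<union> bead_pairs m U = (SIGMA u:U. {t. t < u \<and> m dvd (u - t)})"
    by (auto simp: bead_gaps_def bead_pairs_def)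
  also have "card \<dots> = (\<Sum>u\<in>U. card {t. t < u \<and> m dvd (u - t)})"
    using assms by (intro card_SigmaI) auto
  also have "\<dots> = (\<Sum>u\<in>U. u div m)" using assms by (simp add: card_multiples_below)
  finally show ?thesis .
qed

section \<open>The effect of lowering one bead\<close>

lemma bead_pairs_insert:
  assumes "x \<notin> V"
  shows "bead_pairs m (insert x V) = bead_pairs m V \<union> (\<lambda>y. (max x y, min x y)) ` cls m x V"
    (is "?L = _ \<union> ?f ` _" is "_ = ?R")
proof (intro equalityI subsetI)
  fix z assume "z \<in> ?L"
  then obtain u t where z: "z = (u, t)" "u \<in> insert x V" "t \<in> insert x V" "t < u" "m dvd (u - t)"
    by (auto simp: bead_pairs_def)
  then have c: "u mod m = t mod m" by (simp add: mod_eq_dvd_iff_nat)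
  consider "u = x" "t \<in> V" | "t = x" "u \<in> V" | "u \<in> V" "t \<in> V" using z by auto
  then show "z \<in> ?R"
  proof cases
    case 1 then have "t \<in> cls m x V" "z = ?f t" using z c by (auto simp: cls_def)
    then have "z \<in> ?f ` cls m x V" by (intro image_eqI)
    then show ?thesis by (rule UnI2)
  next
    case 2 then have "u \<in> cls m x V" "z = ?f u" using z c by (auto simp: cls_def)
    then have "z \<in> ?f ` cls m x V" by (intro image_eqI)
    then show ?thesis by (rule UnI2)
  next
    case 3 then show ?thesis using z by (auto simp: bead_pairs_def)
  qed
next
  fix z assume "z \<in> ?R"
  then show "z \<in> ?L"
  proof
    assume "z \<in> ?f ` cls m x V"
    then obtain y where y: "y \<in> V" "y mod m = x mod m" "z = ?f y" by (auto simp: cls_def)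
    then have "y \<noteq> x" using assms by auto
    then show ?thesis using y mod_eq_dvd_iff_nat[of x y m] mod_eq_dvd_iff_nat[of y x m]
      by (cases "x < y") (auto simp: bead_pairs_def)
  qed (auto simp: bead_pairs_def)
qed

lemma inj_max_min: "inj (\<lambda>y::nat. (max x y, min x y))"
  by (rule injI) (auto simp: max_def min_def split: if_splits)

lemma bead_pairs_insert_disjoint:
  "x \<notin> V \<Longrightarrow> bead_pairs m V \<inter> (\<lambda>y. (max x y, min x y)) ` A = {}"
  by (auto simp: bead_pairs_def max_def min_def split: if_splits)

lemma card_bead_pairs_insert:
  assumes "finite V" "x \<notin> V"
  shows "card (bead_pairs m (insert x V)) = card (bead_pairs m V) + card (cls m x V)"
  using assms bead_pairs_insert_disjoint[OF assms(2), of m "cls m x V"]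
  by (simp add: bead_pairs_insert card_Un_disjoint card_image inj_on_subset[OF inj_max_min])

text \<open>Both bead sets arise from \<open>U - {x}\<close> by adding one bead. Apply
  \<open>weight_plus_pairs\<close> to each; the pairs inside \<open>U - {x}\<close> cancel.\<close>

lemma weight_move:
  assumes "finite U" "0 < m" "x \<in> U" "y \<notin> U"
  shows "weight m (insert y (U - {x})) + card (cls m y (U - {x})) + x div m
       = weight m U + card (cls m x (U - {x})) + y div m"
proof -
  let ?V = "U - {x}"
  have U: "insert x ?V = U" using assms by auto
  have "weight m U + card (bead_pairs m ?V) + card (cls m x ?V) = x div m + (\<Sum>u\<in>?V. u div m)"
    using weight_plus_pairs[of U m] card_bead_pairs_insert[of ?V x m] assms U
      sum.remove[of U x "\<lambda>u. u div m"] by simp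
  moreover have "weight m (insert y ?V) + card (bead_pairs m ?V) + card (cls m y ?V)
      = y div m + (\<Sum>u\<in>?V. u div m)"
    using weight_plus_pairs[of "insert y ?V" m] card_bead_pairs_insert[of ?V y m] assms by simp
  ultimately show ?thesis by linarith
qed

lemma mod_diff_mult_eq:
  fixes x q m :: nat assumes "m dvd q" "q \<le> x" shows "(x - q) mod m = x mod m"
  using assms mod_eq_dvd_iff_nat[of "x - q" x m] by simp

lemma mod_minus_neq:
  fixes x q m :: nat assumes "0 < q" "q < m" "q \<le> x" shows "(x - q) mod m \<noteq> x mod m"
proof
  assume "(x - q) mod m = x mod m"
  then have "x mod m = (x - q) mod m" by (rule sym)
  then have "m dvd x - (x - q)" using mod_eq_dvd_iff_nat[of "x - q" x m] by simp
  then show False using assms by (auto dest: dvd_imp_le)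
qed

text \<open>The bead stays on its runner, so only its quotient by \<open>m\<close> changes.\<close>

lemma weight_move_multiple:
  assumes "finite U" "0 < m" "x \<in> U" "q \<le> x" "x - q \<notin> U" "m dvd q"
  shows "weight m (insert (x - q) (U - {x})) + q div m = weight m U"
proof -
  have "(x - q) mod m = x mod m" using assms by (simp add: mod_diff_mult_eq)
  then have "cls m (x - q) (U - {x}) = cls m x (U - {x})" by (simp add: cls_def)
  moreover have "x div m = (x - q) div m + q div m"
  proof -
    have "x = (x - q) + q" using assms by simp
    then show ?thesis using assms(6) by (metis div_plus_div_distrib_dvd_right)
  qed
  ultimately show ?thesis using weight_move[of U m x "x - q"] assms by simp
qed

lemma card_cls_move_multiple:
  assumes "finite U" "x \<in> U" "q \<le> x" "x - q \<notin> U" "m dvd q"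
  shows "card (cls m c (insert (x - q) (U - {x}))) = card (cls m c U)"
proof -
  have e: "(x - q) mod m = x mod m" using assms by (simp add: mod_diff_mult_eq)
  show ?thesis
  proof (cases "x mod m = c mod m")
    case True
    have "cls m c (insert (x - q) (U - {x})) = insert (x - q) (cls m c U - {x})"
      using True e by (auto simp: cls_def)
    moreover have "x - q \<notin> cls m c U" "x \<in> cls m c U" using True assms by (auto simp: cls_def)
    moreover from this have "0 < card (cls m c U)" using assms by (auto simp: card_gt_0_iff)
    ultimately show ?thesis using assms by simp
  next
    case False
    then have "cls m c (insert (x - q) (U - {x})) = cls m c U"
      using e by (auto simp: cls_def)
    then show ?thesis by simp
  qed
qed

text \<open>The residue of \<open>x - q\<close> is written as \<open>x + (m - q)\<close> to avoid
  truncated subtraction. The extra 1 stands for the one negative position, among those from -q to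
  -1, that lies in this class when \<open>x mod m < q\<close>.\<close>

lemma card_cls_blocked:
  assumes "finite U" "0 < q" "q \<le> m"
  shows "card (cls m x (blocked q U)) = card (cls m (x + (m - q)) U) + of_bool (x mod m < q)"
proof -
  let ?A = "{y. y < q \<and> y mod m = x mod m}" and ?B = "(\<lambda>z. z + q) ` cls m (x + (m - q)) U"
  have shift: "(z + q) mod m = x mod m \<longleftrightarrow> z mod m = (x + (m - q)) mod m" for z
  proof
    assume "(z + q) mod m = x mod m"
    then have "(z + q + (m - q)) mod m = (x + (m - q)) mod m" by (metis mod_add_left_eq)
    then show "z mod m = (x + (m - q)) mod m" using assms by simp
  next
    assume "z mod m = (x + (m - q)) mod m"
    then have "(z + q) mod m = (x + (m - q) + q) mod m" by (metis mod_add_left_eq)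
    then show "(z + q) mod m = x mod m" using assms by simp
  qed
  have "cls m x (blocked q U) = ?A \<union> ?B"
  proof (intro equalityI subsetI)
    fix y assume y: "y \<in> cls m x (blocked q U)"
    show "y \<in> ?A \<union> ?B"
    proof (cases "y < q")
      case False
      then have "y - q \<in> cls m (x + (m - q)) U" "y = (y - q) + q"
        using y shift[of "y - q"] by (auto simp: cls_def blocked_def)
      then show ?thesis by blast
    qed (use y in \<open>auto simp: cls_def\<close>)
  next
    fix y assume "y \<in> ?A \<union> ?B"
    then show "y \<in> cls m x (blocked q U)" using shift by (auto simp: cls_def blocked_def)
  qed
  moreover have "?A \<inter> ?B = {}" by auto
  moreover have "?A = (if x mod m < q then {x mod m} else {})"
    using assms by auto
  moreover have "card ?B = card (cls m (x + (m - q)) U)" by (intro card_image) (simp add: inj_on_def)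
  ultimately show ?thesis using assms by (auto simp: card_Un_disjoint)
qed

lemma div_minus_lt:
  fixes x q m :: nat assumes "q \<le> x" "0 < q" "q < m"
  shows "x div m = (x - q) div m + of_bool (x mod m < q)"
proof (cases "x mod m < q")
  case False
  have "x - q = m * (x div m) + (x mod m - q)" using False mult_div_mod_eq[of m x] by linarith
  moreover have "x mod m - q < m" using assms by (meson le_less_trans diff_le_self mod_less_divisor less_trans)
  ultimately have "(x - q) div m = x div m" using assms by simp
  then show ?thesis using False by simp
next
  case True
  then have "0 < x div m" using assms by (metis div_greater_zero_iff leD le_less_linear mod_less
        order_less_trans)
  then obtain a where a: "x div m = Suc a" by (cases "x div m") auto
  have lt: "m + x mod m - q < m" using True assms by linarith
  have "x - q = m * a + (m + x mod m - q)"
    using a mult_div_mod_eq[of m x] assms by (simp add: algebra_simps)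
  then have "(x - q) div m = a + (m + x mod m - q) div m"
    using assms by (simp only: div_mult_self4)
  then have "(x - q) div m = a" using lt by simp
  then show ?thesis using a True by simp
qed

text \<open>The occupied negative positions in \<open>blocked\<close> account exactly for the borrow
  in \<open>div_minus_lt\<close>, so that no case distinction on \<open>x mod m < q\<close> survives
  in the formula.\<close>

lemma weight_move_blocked:
  assumes "finite U" "x \<in> U" "q \<le> x" "x - q \<notin> U" "0 < q" "q < m"
  shows "weight m (insert (x - q) (U - {x})) + card (cls m x (blocked q U)) + 1
       = weight m U + card (cls m x U)"
proof -
  have ne: "(x - q) mod m \<noteq> x mod m" using assms by (intro mod_minus_neq) auto
  have "(x + (m - q)) mod m = (x - q + m) mod m" using assms by simp
  then have "(x + (m - q)) mod m = (x - q) mod m" by simp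
  then have "cls m (x + (m - q)) U = cls m (x - q) U" by (simp add: cls_def)
  then have b: "card (cls m x (blocked q U)) = card (cls m (x - q) U) + of_bool (x mod m < q)"
    using card_cls_blocked[of U q m x] assms by simp
  have "cls m (x - q) (U - {x}) = cls m (x - q) U" using ne by (auto simp: cls_def)
  moreover have "cls m x (U - {x}) = cls m x U - {x}" by (auto simp: cls_def)
  then have "card (cls m x (U - {x})) + 1 = card (cls m x U)"
    using assms card.remove[of "cls m x U" x] by (simp add: cls_def)
  ultimately show ?thesis
    using weight_move[of U m x "x - q"] assms b div_minus_lt[of q x m] by simp
qed

section \<open>Lowering several beads of one runner\<close>

definition shift_down :: "nat \<Rightarrow> nat set \<Rightarrow> nat set \<Rightarrow> nat set" where
  "shift_down q S U = (U - S) \<union> (\<lambda>x. x - q) ` S"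

lemma shift_down_insert:
  assumes "x \<notin> S" "x \<in> U" "\<forall>y\<in>insert x S. q \<le> y \<and> y - q \<notin> U"
  shows "shift_down q (insert x S) U = insert (x - q) (shift_down q S U - {x})"
    and "x \<in> shift_down q S U" "x - q \<notin> shift_down q S U"
proof -
  have "x \<notin> (\<lambda>x. x - q) ` S" using assms by auto
  then show "shift_down q (insert x S) U = insert (x - q) (shift_down q S U - {x})"
    by (auto simp: shift_down_def)
  show "x \<in> shift_down q S U" using assms by (auto simp: shift_down_def)
  have "y - q \<noteq> x - q" if "y \<in> S" for y
    using that assms(1,3) eq_diff_iff[of q y x] by auto
  then have "x - q \<notin> (\<lambda>x. x - q) ` S" by fastforce
  then show "x - q \<notin> shift_down q S U" using assms(3) by (simp add: shift_down_def)
qed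

lemma finite_shift_down [simp]: "finite U \<Longrightarrow> finite S \<Longrightarrow> finite (shift_down q S U)"
  by (simp add: shift_down_def)

lemma dominated_move:
  assumes "finite U" "x \<in> U" "x - q \<notin> U" 
  shows "dominated (insert (x - q) (U - {x})) U"
proof -
  have "card {z \<in> insert (x - q) (U - {x}). t \<le> z} \<le> card {z \<in> U. t \<le> z}" for t
  proof (cases "t \<le> x - q")
    case True
    then have "{z \<in> insert (x - q) (U - {x}). t \<le> z} = insert (x - q) ({z \<in> U. t \<le> z} - {x})"
      by auto
    moreover have "x \<in> {z \<in> U. t \<le> z}" "x - q \<notin> {z \<in> U. t \<le> z}" using True assms by auto
    moreover from this have "0 < card {z \<in> U. t \<le> z}" using assms by (auto simp: card_gt_0_iff)
    ultimately show ?thesis using assms by simp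
  next
    case False
    then show ?thesis using assms by (intro card_mono) auto
  qed
  moreover have "card (insert (x - q) (U - {x})) = card U" using assms card.remove[of U x] by simp
  ultimately show ?thesis using assms by (simp add: dominated_def)
qed

text \<open>The beads are lowered one by one. Each bead already lowered from the class of
  \<open>x\<close> modulo \<open>m\<close> makes that class smaller by one and its blocked part
  larger by one, so the move of \<open>x\<close> contributes the difference for \<open>U\<close>
  minus \<open>2 * card (cls m x S) + 1\<close>. This is the growth of the sum of
  \<open>card (cls m y S)\<close> over \<open>S\<close>, the number of ordered congruent pairs in
  \<open>S\<close>, when \<open>x\<close> is added.\<close>

lemma weight_shift_down:
  assumes fin: "finite U" "finite S" and S: "S \<subseteq> U" "\<And>y. y \<in> S \<Longrightarrow> q \<le> y \<and> y - q \<notin> U"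
    and cl: "\<And>y z. y \<in> S \<Longrightarrow> z \<in> S \<Longrightarrow> y mod M = z mod M"
    and M: "0 < q" "q < M" "M dvd m" "0 < m"
  shows "int (weight m (shift_down q S U)) = int (weight m U) +
    (\<Sum>y\<in>S. int (card (cls m y U)) - int (card (cls m y (blocked q U))) - int (card (cls m y S)))"
  using fin(2) S cl
proof (induction S)
  case empty
  then show ?case by (simp add: shift_down_def)
next
  case (insert x S)
  let ?W = "shift_down q S U"
  have "q < m" using M by (meson dvd_imp_le less_le_trans)
  have prem: "\<forall>y\<in>insert x S. q \<le> y \<and> y - q \<notin> U" using insert.prems by blast
  have xU: "x \<in> U" using insert.prems by auto
  note sd = shift_down_insert[OF insert.hyps(2) xU prem]
  have finW: "finite ?W" using insert.hyps fin by simp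
  have modM: "a mod M = b mod M" if "a mod m = b mod m" for a b
    using that M(3) by (metis mod_mod_cancel)
  \<comment> \<open>Since \<open>q < M\<close>, a lowered bead leaves the common class modulo
    \<open>M\<close> and never returns to the class of \<open>x\<close> modulo
    \<open>m\<close>.\<close>
  have no: "(y - q) mod M \<noteq> x mod M" if "y \<in> S" for y
    using mod_minus_neq[of q M y] M prem that insert.prems(3)[of y x] by auto
  have "cls m x ?W = cls m x U - cls m x S"
  proof (intro equalityI subsetI)
    fix z assume "z \<in> cls m x ?W"
    then have z: "z \<in> U - S \<or> z \<in> (\<lambda>x. x - q) ` S" "z mod m = x mod m"
      by (auto simp: cls_def shift_down_def)
    moreover have "z \<notin> (\<lambda>x. x - q) ` S" using no modM[OF z(2)] by auto
    ultimately show "z \<in> cls m x U - cls m x S" by (auto simp: cls_def)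
  qed (auto simp: cls_def shift_down_def)
  moreover have sub: "cls m x S \<subseteq> cls m x U" using insert.prems by (auto simp: cls_def)
  ultimately have c1: "int (card (cls m x ?W)) = int (card (cls m x U)) - int (card (cls m x S))"
    using insert.hyps fin by (simp add: card_Diff_subset card_mono of_nat_diff)
  have "cls m x (blocked q ?W) = cls m x (blocked q U) \<union> cls m x S"
  proof (intro equalityI subsetI)
    fix z assume "z \<in> cls m x (blocked q ?W)"
    then have z: "z mod m = x mod m" "z < q \<or> z - q \<in> U \<or> z - q \<in> (\<lambda>x. x - q) ` S"
      by (auto simp: cls_def blocked_def shift_down_def)
    have "z \<in> S" if "z - q = y - q" "y \<in> S" "\<not> z < q" for y
      using that prem eq_diff_iff[of q z y] by auto
    then show "z \<in> cls m x (blocked q U) \<union> cls m x S"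
      using z by (auto simp: cls_def blocked_def)
  next
    fix z assume z: "z \<in> cls m x (blocked q U) \<union> cls m x S"
    then have zm: "z mod m = x mod m" by (auto simp: cls_def)
    have "z - q \<notin> S" if "\<not> z < q"
    proof
      assume zS: "z - q \<in> S"
      have "(z - q) mod M = x mod M" using insert.prems(3) zS by blast
      then have "(z - q) mod M = z mod M" using modM[OF zm] by simp
      then show False using mod_minus_neq[of q M z] that M by auto
    qed
    then show "z \<in> cls m x (blocked q ?W)"
      using z by (auto simp: cls_def blocked_def shift_down_def)
  qed
  moreover have "cls m x (blocked q U) \<inter> cls m x S = {}"
    using prem by (fastforce simp: cls_def blocked_def)
  ultimately have c2: "card (cls m x (blocked q ?W)) = card (cls m x (blocked q U)) + card (cls m x S)"
    using insert.hyps fin by (simp add: card_Un_disjoint)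
  have step: "weight m (shift_down q (insert x S) U) + card (cls m x (blocked q ?W)) + 1
       = weight m ?W + card (cls m x ?W)"
    unfolding sd(1)
    by (rule weight_move_blocked) (use finW sd(2,3) prem M \<open>q < m\<close> in auto)
  have IH: "int (weight m ?W) = int (weight m U) +
    (\<Sum>y\<in>S. int (card (cls m y U)) - int (card (cls m y (blocked q U))) - int (card (cls m y S)))"
    using insert.IH insert.prems by blast
  have ci: "int (card (cls m y (insert x S))) = int (card (cls m y S)) + of_bool (y mod m = x mod m)" for y
  proof (cases "y mod m = x mod m")
    case True
    then have "cls m y (insert x S) = insert x (cls m y S)" by (auto simp: cls_def)
    moreover have "x \<notin> cls m y S" using insert.hyps by (auto simp: cls_def)
    ultimately show ?thesis using True insert.hyps by simp
  next
    case False
    then have "cls m y (insert x S) = cls m y S" by (auto simp: cls_def)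
    then show ?thesis using False by simp
  qed
  have "x \<notin> cls m x S" using insert.hyps by (simp add: cls_def)
  have cnt: "S \<inter> {y. y mod m = x mod m} = cls m x S" by (auto simp: cls_def)
  have "(\<Sum>y\<in>insert x S. int (card (cls m y U)) - int (card (cls m y (blocked q U))) - int (card (cls m y (insert x S))))
     = int (card (cls m x U)) - int (card (cls m x (blocked q U))) - int (card (cls m x S)) - 1 +
       ((\<Sum>y\<in>S. int (card (cls m y U)) - int (card (cls m y (blocked q U))) - int (card (cls m y S)))
        - int (card (cls m x S)))"
    using insert.hyps \<open>x \<notin> cls m x S\<close> by (simp add: ci sum_subtractf sum.distrib cnt)
  then show ?case using step c1 c2 IH by linarith
qed

lemma dominated_shift_down:
  assumes fin: "finite U" "finite S" and S: "S \<subseteq> U" "\<And>y. y \<in> S \<Longrightarrow> q \<le> y \<and> y - q \<notin> U"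
  shows "dominated (shift_down q S U) U"
  using fin(2) S
proof (induction S)
  case empty
  then show ?case using fin by (simp add: shift_down_def dominated_refl)
next
  case (insert x S)
  have "x \<in> U" and prem: "\<forall>y\<in>insert x S. q \<le> y \<and> y - q \<notin> U"
    using insert.prems by auto
  note sd = shift_down_insert[OF insert.hyps(2) this]
  have "dominated (shift_down q (insert x S) U) (shift_down q S U)"
    unfolding sd(1) using sd(2,3) insert.hyps fin by (intro dominated_move) auto
  moreover have "dominated (shift_down q S U) U" using insert by auto
  ultimately show ?case by (rule dominated_trans)
qed

lemma weight_shift_down_multiple:
  assumes fin: "finite U" "finite S" and S: "S \<subseteq> U" "\<And>y. y \<in> S \<Longrightarrow> q \<le> y \<and> y - q \<notin> U"
    and m: "0 < m" "m dvd q"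
  shows "weight m (shift_down q S U) + card S * (q div m) = weight m U"
  using fin(2) S
proof (induction S)
  case empty
  then show ?case by (simp add: shift_down_def)
next
  case (insert x S)
  have "x \<in> U" and prem: "\<forall>y\<in>insert x S. q \<le> y \<and> y - q \<notin> U"
    using insert.prems by auto
  note sd = shift_down_insert[OF insert.hyps(2) this]
  have "weight m (shift_down q (insert x S) U) + q div m = weight m (shift_down q S U)"
    unfolding sd(1) using sd(2,3) insert.hyps fin prem m by (intro weight_move_multiple) auto
  moreover have "weight m (shift_down q S U) + card S * (q div m) = weight m U"
    using insert by auto
  ultimately show ?case using insert.hyps by simp
qed

section \<open>Runners with more beads than the preceding one\<close>

lemma bead_gap_step:
  fixes U :: "nat set"
  assumes "u \<in> U" "t \<notin> U" "t < u" "m dvd (u - t)"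
  shows "\<exists>v\<in>U. m \<le> v \<and> v - m \<notin> U"
proof (rule ccontr)
  assume "\<not> ?thesis"
  then have step: "v - m \<in> U" if "v \<in> U" "m \<le> v" for v using that by blast
  obtain d where d: "u - t = m * d" using assms by auto
  \<comment> \<open>Without a bead that can be lowered by \<open>m\<close>, the walk from
    \<open>u\<close> down to \<open>t\<close> in steps of \<open>m\<close> would meet beads
    only.\<close>
  have "u - m * i \<in> U" if "i \<le> d" for i
    using that
  proof (induction i)
    case (Suc i)
    have "m * Suc i \<le> m * d" using Suc.prems by (rule mult_le_mono2)
    then have "m \<le> u - m * i" using d by simp
    then show ?case using step[of "u - m * i"] Suc by (simp add: diff_diff_left add.commute)
  qed (use assms in simp)
  from this[of d] have "t \<in> U" using d assms by (metis diff_diff_cancel less_imp_le order_refl)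
  then show False using assms by simp
qed

lemma weight_pos_step:
  assumes "0 < weight m U"
  shows "\<exists>v\<in>U. m \<le> v \<and> v - m \<notin> U"
proof -
  obtain x where "x \<in> {(u, t) \<in> bead_gaps U. m dvd (u - t)}"
    using assms unfolding weight_def card_gt_0_iff by blast
  then obtain u t where "u \<in> U" "t \<notin> U" "t < u" "m dvd (u - t)"
    by (auto simp: bead_gaps_def)
  then show ?thesis by (rule bead_gap_step)
qed

lemma weight_zero_closed:
  assumes "finite U" "weight m U = 0" "u \<in> U" "t \<le> u" "t mod m = u mod m"
  shows "t \<in> U"
proof (rule ccontr)
  assume t: "t \<notin> U"
  then have "t < u" using assms by (metis le_neq_implies_less)
  moreover have "m dvd (u - t)" using assms mod_eq_dvd_iff_nat[of t u m] by simp
  ultimately have "(u, t) \<in> {(u, t) \<in> bead_gaps U. m dvd (u - t)}" using t assms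
    by (auto simp: bead_gaps_def)
  moreover have "finite {(u, t) \<in> bead_gaps U. m dvd (u - t)}"
    by (rule finite_subset[OF _ finite_bead_gaps[OF assms(1)]]) auto
  ultimately show False using assms(2) unfolding weight_def by (simp only: card_0_eq) blast
qed

text \<open>Sliding beads down by \<open>p * q\<close> preserves all class sizes and reduces the weights to
  the case \<open>weight (p * q) U = 0\<close>, where the runners are flush.\<close>

lemma unbalanced_class:
  assumes "finite U" "0 < q" "2 \<le> p"
  shows "p * weight (p * q) U \<le> weight q U \<and>
    (p * weight (p * q) U < weight q U \<longrightarrow>
      (\<exists>c. card (cls (p * q) c (blocked q U)) < card (cls (p * q) c U)))"
  using assms(1)
proof (induction "weight (p * q) U" arbitrary: U)
  case 0
  have "\<exists>c. card (cls (p * q) c (blocked q U)) < card (cls (p * q) c U)" if pos: "0 < weight q U"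
  proof -
    obtain u where u: "u \<in> U" "q \<le> u" "u - q \<notin> U" using weight_pos_step[OF pos] by blast
    note closed = weight_zero_closed[OF 0(2) 0(1)[symmetric]]
    \<comment> \<open>A blocked position \<open>z\<close> above \<open>u\<close> in this class would
      have the bead \<open>z - q\<close>, and since the runners are flush, this would force the bead
      \<open>u - q\<close> as well. So every blocked position lies below \<open>u\<close> or at it,
      where the flush runner of \<open>u\<close> has beads only.\<close>
    have "cls (p * q) u (blocked q U) \<subseteq> cls (p * q) u U"
    proof
      fix z assume "z \<in> cls (p * q) u (blocked q U)"
      then have z: "z mod (p * q) = u mod (p * q)" "z < q \<or> z - q \<in> U"
        by (auto simp: cls_def blocked_def)
      have "z \<le> u"
      proof (rule ccontr)
        assume "\<not> z \<le> u"
        then have "p * q dvd z - u" using z mod_eq_dvd_iff_nat[of u z "p * q"] by simp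
        then have "p * q dvd (z - q) - (u - q)" using u \<open>\<not> z \<le> u\<close> by simp
        then have c: "(u - q) mod (p * q) = (z - q) mod (p * q)"
          using \<open>\<not> z \<le> u\<close> mod_eq_dvd_iff_nat[of "u - q" "z - q" "p * q"] by simp
        have "z - q \<in> U" using z u \<open>\<not> z \<le> u\<close> by auto
        then have "u - q \<in> U" by (rule closed[OF _ _ c]) (use \<open>\<not> z \<le> u\<close> in simp)
        then show False using u by simp
      qed
      then have "z \<in> U" using closed[of u z] u z by simp
      then show "z \<in> cls (p * q) u U" using z by (simp add: cls_def)
    qed
    moreover have "u \<in> cls (p * q) u U" "u \<notin> cls (p * q) u (blocked q U)"
      using u by (auto simp: cls_def blocked_def)
    ultimately have "cls (p * q) u (blocked q U) \<subset> cls (p * q) u U" by blast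
    then show ?thesis using 0 by (meson finite_cls psubset_card_mono)
  qed
  then show ?case using 0 by simp
next
  case (Suc n)
  let ?m = "p * q"
  have m: "0 < ?m" "q \<le> ?m" using assms by auto
  obtain x where x: "x \<in> U" "?m \<le> x" "x - ?m \<notin> U" using weight_pos_step[of ?m U] Suc(2) by auto
  \<comment> \<open>This slide lowers \<open>weight (p * q)\<close> by 1 and \<open>weight q\<close>
    by \<open>p\<close>, so the comparison of \<open>p * weight (p * q)\<close> with
    \<open>weight q\<close> is unaffected.\<close>
  define V where "V = insert (x - ?m) (U - {x})"
  have finV: "finite V" using Suc by (simp add: V_def)
  have w: "weight ?m V + 1 = weight ?m U" "weight q V + p = weight q U"
    using weight_move_multiple[of U ?m x ?m] weight_move_multiple[of U q x ?m] x m Suc.prems assms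
    unfolding V_def by auto
  have c: "card (cls ?m c V) = card (cls ?m c U)" for c
    unfolding V_def using x Suc.prems by (intro card_cls_move_multiple) auto
  have b: "card (cls ?m c (blocked q V)) = card (cls ?m c (blocked q U))" for c
    using card_cls_blocked[of _ q ?m c] finV Suc.prems m assms by (simp add: c)
  have "p * weight ?m V \<le> weight q V \<and> (p * weight ?m V < weight q V \<longrightarrow>
      (\<exists>c. card (cls ?m c (blocked q V)) < card (cls ?m c V)))"
    using Suc.hyps(1)[of V] Suc.hyps(2) w finV by simp
  moreover have "p * weight ?m U = p * weight ?m V + p"
    using w(1) by (metis add_mult_distrib2 mult.right_neutral)
  ultimately show ?case using w(2) b c by (simp add: algebra_simps)
qed

section \<open>Choosing beads along the tree of residue classes\<close>

lemma card_cls_refine: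
  assumes "finite A" "0 < p" "0 < q"
  shows "card (cls q c A) = (\<Sum>e | e < p * q \<and> e mod q = c mod q. card (cls (p * q) e A))"
proof -
  let ?I = "{e. e < p * q \<and> e mod q = c mod q}"
  have "cls q c A = (\<Union>e\<in>?I. cls (p * q) e A)"
  proof (intro equalityI subsetI)
    fix x assume x: "x \<in> cls q c A"
    have "x mod (p * q) \<in> ?I" using x assms by (auto simp: cls_def mod_mod_cancel)
    moreover have "x \<in> cls (p * q) (x mod (p * q)) A" using x by (simp add: cls_def)
    ultimately show "x \<in> (\<Union>e\<in>?I. cls (p * q) e A)" by blast
  next
    fix x assume "x \<in> (\<Union>e\<in>?I. cls (p * q) e A)"
    then obtain e where e: "e mod q = c mod q" "x \<in> A" "x mod (p * q) = e mod (p * q)"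
      by (auto simp: cls_def)
    then have "x mod q = e mod q" by (metis dvd_triv_right mod_mod_cancel)
    then show "x \<in> cls q c A" using e by (simp add: cls_def)
  qed
  moreover have "card (\<Union>e\<in>?I. cls (p * q) e A) = (\<Sum>e\<in>?I. card (cls (p * q) e A))"
    using assms by (intro card_UN_disjoint) (auto simp: cls_def)
  ultimately show ?thesis by simp
qed

text \<open>Pigeonhole down the tree of residue classes modulo \<open>p ^ L\<close>; the same element works
  for all moduli at once.\<close>

lemma excess_element:
  assumes fin: "finite A" "finite B" and p: "2 \<le> p"
    and le: "card (cls (p ^ L) c B) < card (cls (p ^ L) c A)"
  shows "\<exists>x\<in>cls (p ^ L) c A. \<forall>K\<ge>L. card (cls (p ^ K) x B) < card (cls (p ^ K) x A)"
proof -
  \<comment> \<open>From level \<open>M\<close> on, distinct elements of \<open>A\<close> and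
    \<open>B\<close> lie in distinct classes. The summand \<open>L\<close> ensures
    \<open>L \<le> M\<close>, so that the induction can run from \<open>M\<close> down to
    \<open>L\<close>.\<close>
  define M where "M = L + Max (insert 0 (A \<union> B))"
  have small: "x < p ^ K" if "x \<in> A \<union> B" "M \<le> K" for x K
  proof -
    have "x \<le> M" using that fin by (auto simp: M_def intro: trans_le_add2)
    also have "M \<le> K" by fact
    also have "K < p ^ K" using p by (intro less_exp[THEN less_le_trans] power_mono) auto
    finally show ?thesis .
  qed
  have "L \<le> M" by (simp add: M_def)
  then show ?thesis using le
  proof (induction arbitrary: c rule: inc_induct)
    case base
    have single: "cls (p ^ K) x A = A \<inter> {x}" "cls (p ^ K) x B = B \<inter> {x}"
      if "M \<le> K" "x \<in> A" for K x
      using small that by (auto simp: cls_def)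
    have "cls (p ^ M) c A \<noteq> {}" using base by (metis card.empty not_less_zero)
    then obtain x where x: "x \<in> cls (p ^ M) c A" by blast
    then have "x \<in> A" "cls (p ^ M) c A = cls (p ^ M) x A" "cls (p ^ M) c B = cls (p ^ M) x B"
      by (auto simp: cls_def)
    then have "x \<in> A" "x \<notin> B" using base single[of M x] by (auto split: if_splits)
    then have "\<forall>K\<ge>M. card (cls (p ^ K) x B) < card (cls (p ^ K) x A)" by (simp add: single)
    then show ?case using x by blast
  next
    case (step n)
    have "\<exists>e. e mod p ^ n = c mod p ^ n \<and> card (cls (p ^ Suc n) e B) < card (cls (p ^ Suc n) e A)"
    proof (rule ccontr)
      assume "\<not> ?thesis"
      then have "card (cls (p ^ n) c A) \<le> card (cls (p ^ n) c B)"
        using p fin card_cls_refine[of _ p "p ^ n" c] by (auto intro!: sum_mono simp: not_less)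
      then show False using step.prems by simp
    qed
    then obtain e where e: "e mod p ^ n = c mod p ^ n"
      "card (cls (p ^ Suc n) e B) < card (cls (p ^ Suc n) e A)" by blast
    from step.IH[OF e(2)] obtain x where x: "x \<in> cls (p ^ Suc n) e A"
      "\<forall>K\<ge>Suc n. card (cls (p ^ K) x B) < card (cls (p ^ K) x A)" by blast
    have "x mod p ^ Suc n = e mod p ^ Suc n" using x(1) by (simp add: cls_def)
    moreover have "p ^ n dvd p ^ Suc n" by simp
    ultimately have "x mod p ^ n = e mod p ^ n" by (metis mod_mod_cancel)
    then have xc: "x mod p ^ n = c mod p ^ n" using e by simp
    then have "cls (p ^ n) x A = cls (p ^ n) c A" "cls (p ^ n) x B = cls (p ^ n) c B"
      by (simp_all add: cls_def)
    then have "card (cls (p ^ n) x B) < card (cls (p ^ n) x A)" using step.prems by simp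
    then have "\<forall>K\<ge>n. card (cls (p ^ K) x B) < card (cls (p ^ K) x A)"
      using x(2) by (metis le_antisym not_less_eq_eq)
    moreover have "x \<in> cls (p ^ n) c A" using x(1) xc by (auto simp: cls_def)
    ultimately show ?case by blast
  qed
qed

text \<open>Greedy choice: the elements already chosen are taken out of \<open>A\<close>, and
  \<open>excess_element\<close> supplies an \<open>x\<close> whose classes are in excess at every
  level. Where \<open>y\<close> is congruent to \<open>x\<close>, the excess of \<open>x\<close>
  leaves room for one more element; elsewhere the old bound persists. The bound at all levels at
  once is what keeps the weights from decreasing later.\<close>

lemma excess_subset:
  assumes fin: "finite A" "finite B" and p: "2 \<le> p"
    and s: "card (cls (p ^ L) c B) + s \<le> card (cls (p ^ L) c A)"
  shows "\<exists>S. S \<subseteq> cls (p ^ L) c A \<and> card S = s \<and>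
    (\<forall>y\<in>S. \<forall>K\<ge>L. card (cls (p ^ K) y S) + card (cls (p ^ K) y B) \<le> card (cls (p ^ K) y A))"
  using s
proof (induction s)
  case 0
  then show ?case by (intro exI[of _ "{}"]) auto
next
  case (Suc s)
  then obtain S where S: "S \<subseteq> cls (p ^ L) c A" "card S = s"
    "\<forall>y\<in>S. \<forall>K\<ge>L. card (cls (p ^ K) y S) + card (cls (p ^ K) y B) \<le> card (cls (p ^ K) y A)"
    by auto
  have finS: "finite S" using S fin by (meson finite_cls finite_subset)
  have SA: "S \<subseteq> A" using S by (auto simp: cls_def)
  have diff: "card (cls m x (A - S)) + card (cls m x S) = card (cls m x A)" for m x
  proof -
    have "cls m x (A - S) = cls m x A - cls m x S" "cls m x S \<subseteq> cls m x A"
      using SA by (auto simp: cls_def)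
    then show ?thesis using fin finS by (simp add: card_Diff_subset card_mono)
  qed
  have "cls (p ^ L) c S = S" using S by (auto simp: cls_def)
  then have "card (cls (p ^ L) c B) < card (cls (p ^ L) c (A - S))"
    using diff[of "p ^ L" c] S Suc.prems by simp
  from excess_element[OF _ fin(2) p this] fin obtain x where x: "x \<in> cls (p ^ L) c (A - S)"
    "\<forall>K\<ge>L. card (cls (p ^ K) x B) < card (cls (p ^ K) x (A - S))" by auto
  have "x \<notin> S" using x by (simp add: cls_def)
  have "card (cls (p ^ K) y (insert x S)) + card (cls (p ^ K) y B) \<le> card (cls (p ^ K) y A)"
    if "y \<in> insert x S" "L \<le> K" for y K
  proof (cases "y mod p ^ K = x mod p ^ K")
    case True
    then have e: "cls (p ^ K) y C = cls (p ^ K) x C" for C by (simp add: cls_def)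
    have "cls (p ^ K) x (insert x S) = insert x (cls (p ^ K) x S)" by (auto simp: cls_def)
    then have "card (cls (p ^ K) x (insert x S)) \<le> Suc (card (cls (p ^ K) x S))"
      using card_insert_le_m1 finS by (simp add: card_insert_if)
    moreover have "card (cls (p ^ K) x B) < card (cls (p ^ K) x (A - S))" using x that by blast
    ultimately show ?thesis using diff[of "p ^ K" x] by (simp add: e)
  next
    case False
    then have "cls (p ^ K) y (insert x S) = cls (p ^ K) y S" by (auto simp: cls_def)
    then show ?thesis using S(3) that False by auto
  qed
  moreover have "card (insert x S) = Suc s" using \<open>x \<notin> S\<close> finS S by simp
  moreover have "insert x S \<subseteq> cls (p ^ L) c A" using S x by (auto simp: cls_def)
  ultimately show ?case by blast
qed

text \<open>Lowering \<open>s\<close> beads by \<open>p ^ j\<close> removes \<open>s\<close> hooks of length \<open>p ^ j\<close>. The number \<open>a\<close> is the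
  difference in size of two adjacent runners of the abacus.\<close>

lemma abacus_step:
  assumes fin: "finite U" and p: "2 \<le> p" and lt: "p * weight (p ^ Suc j) U < weight (p ^ j) U"
  obtains a where "0 < a" "\<And>s. s \<le> a \<Longrightarrow> \<exists>V. dominated V U \<and>
    (\<forall>L\<le>j. weight (p ^ L) V + s * p ^ (j - L) = weight (p ^ L) U) \<and>
    (\<forall>L>j. weight (p ^ L) U \<le> weight (p ^ L) V) \<and>
    weight (p ^ Suc j) V = weight (p ^ Suc j) U + s * (a - s)"
proof -
  let ?q = "p ^ j" and ?M = "p ^ Suc j"
  have q: "0 < ?q" "?q < ?M" using p by auto
  obtain c where c: "card (cls ?M c (blocked ?q U)) < card (cls ?M c U)"
    using unbalanced_class[OF fin q(1) p] lt by auto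
  define a where "a = card (cls ?M c U) - card (cls ?M c (blocked ?q U))"
  have "\<exists>V. dominated V U \<and>
    (\<forall>L\<le>j. weight (p ^ L) V + s * p ^ (j - L) = weight (p ^ L) U) \<and>
    (\<forall>L>j. weight (p ^ L) U \<le> weight (p ^ L) V) \<and>
    weight (p ^ Suc j) V = weight (p ^ Suc j) U + s * (a - s)" if s: "s \<le> a" for s
  proof -
    have "card (cls ?M c (blocked ?q U)) + s \<le> card (cls ?M c U)" using s c by (simp add: a_def)
    from excess_subset[OF fin finite_blocked[OF fin] p this]
    obtain S where S: "S \<subseteq> cls ?M c U" "card S = s" "\<And>y K. y \<in> S \<Longrightarrow> Suc j \<le> K \<Longrightarrow>
       card (cls (p ^ K) y S) + card (cls (p ^ K) y (blocked ?q U)) \<le> card (cls (p ^ K) y U)"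
      by blast
    have finS: "finite S" using S fin by (meson finite_cls finite_subset)
    have SU: "S \<subseteq> U" using S by (auto simp: cls_def)
    have cl: "y mod ?M = c mod ?M" if "y \<in> S" for y using S that by (auto simp: cls_def)
    \<comment> \<open>The selection bound at a very high level \<open>K\<close> decides this: there
      the class of \<open>y\<close> in \<open>U\<close> is just \<open>y\<close>, and
      \<open>y\<close> itself already uses up the bound, so no blocked position is left in the
      class.\<close>
    have free: "?q \<le> y \<and> y - ?q \<notin> U" if y: "y \<in> S" for y
    proof -
      define K where "K = Suc j + Max (insert 0 U) + p ^ j"
      have big: "x < p ^ K" if "x \<in> U \<or> x = y" for x
      proof -
        have "x \<le> Max (insert 0 U)" using that fin SU y by (intro Max_ge) auto
        then have "x \<le> K" by (simp add: K_def)
        also have "K < p ^ K" using p by (intro less_exp[THEN less_le_trans] power_mono) auto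
        finally show ?thesis .
      qed
      have "cls (p ^ K) y U = {y}" "y \<in> cls (p ^ K) y S"
        using big y SU by (auto simp: cls_def)
      moreover from this have "1 \<le> card (cls (p ^ K) y S)" using finS
        by (metis One_nat_def Suc_leI card_gt_0_iff empty_iff finite_cls)
      moreover have "card (cls (p ^ K) y S) + card (cls (p ^ K) y (blocked ?q U)) \<le> card (cls (p ^ K) y U)"
        by (rule S(3)[OF y]) (simp add: K_def)
      ultimately have "card (cls (p ^ K) y (blocked ?q U)) = 0" by simp
      then have "cls (p ^ K) y (blocked ?q U) = {}" using fin by simp
      then have "y \<notin> blocked ?q U" by (auto simp: cls_def)
      then show ?thesis by (auto simp: blocked_def)
    qed
    let ?V = "shift_down ?q S U"
    have up: "int (weight (p ^ L) ?V) = int (weight (p ^ L) U) +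
    (\<Sum>y\<in>S. int (card (cls (p ^ L) y U)) - int (card (cls (p ^ L) y (blocked ?q U))) - int (card (cls (p ^ L) y S)))"
      if "j < L" for L
    proof (rule weight_shift_down[OF fin finS SU free])
      show "?M dvd p ^ L" using that by (intro le_imp_power_dvd) simp
    qed (use q p cl in auto)
    \<comment> \<open>By the choice of \<open>S\<close>, every summand in \<open>up\<close> is
      nonnegative.\<close>
    have "weight (p ^ L) U \<le> weight (p ^ L) ?V" if L: "j < L" for L
    proof -
      have "0 \<le> (\<Sum>y\<in>S. int (card (cls (p ^ L) y U)) - int (card (cls (p ^ L) y (blocked ?q U))) - int (card (cls (p ^ L) y S)))"
        using S(3)[of _ L] L by (intro sum_nonneg) force
      then show ?thesis using up[OF L] by linarith
    qed
    \<comment> \<open>At this level \<open>S\<close> lies in a single class, so each of its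
      \<open>s\<close> beads contributes \<open>a - s\<close>.\<close>
    moreover have "weight ?M ?V = weight ?M U + s * (a - s)"
    proof -
      have e: "cls ?M y C = cls ?M c C" if "y \<in> S" for y C using cl[OF that] by (simp add: cls_def)
      have "cls ?M c S = S" using S by (auto simp: cls_def)
      then have "(\<Sum>y\<in>S. int (card (cls ?M y U)) - int (card (cls ?M y (blocked ?q U))) - int (card (cls ?M y S)))
        = (\<Sum>y\<in>S. int a - int s)"
        using c S(2) by (intro sum.cong) (simp_all only: e, simp add: a_def of_nat_diff)
      also have "\<dots> = int (s * (a - s))" using S(2) s by (simp add: of_nat_diff)
      finally show ?thesis using up[of "Suc j"] by linarith
    qed
    moreover have "weight (p ^ L) ?V + s * p ^ (j - L) = weight (p ^ L) U" if "L \<le> j" for L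
    proof -
      have "?q div p ^ L = p ^ (j - L)" using that p by (simp add: power_diff)
      then show ?thesis
        using weight_shift_down_multiple[OF fin finS SU free, of "p ^ L"] that p S(2)
        by (simp add: le_imp_power_dvd)
    qed
    moreover have "dominated ?V U" by (rule dominated_shift_down[OF fin finS SU free])
    ultimately show ?thesis by blast
  qed
  moreover have "0 < a" using c by (simp add: a_def)
  ultimately show thesis using that by blast
qed

section \<open>Core towers of tuples\<close>

definition total_weight :: "nat \<Rightarrow> nat \<Rightarrow> (nat \<Rightarrow> nat set) \<Rightarrow> nat" where
  "total_weight k m U = (\<Sum>l<k. weight m (U l))"

text \<open>In terms of core towers, this is the total size of the \<open>p\<close>-cores in row \<open>L\<close>.\<close>

definition core_size :: "nat \<Rightarrow> nat \<Rightarrow> (nat \<Rightarrow> nat set) \<Rightarrow> nat \<Rightarrow> nat" where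
  "core_size p k U L = total_weight k (p ^ L) U - p * total_weight k (p ^ Suc L) U"

lemma total_weight_upd:
  assumes "l < k"
  shows "total_weight k m (U(l := A)) + weight m (U l) = total_weight k m U + weight m A"
proof -
  have "total_weight k m W = weight m (W l) + (\<Sum>i\<in>{..<k} - {l}. weight m (W i))" for W
    using assms unfolding total_weight_def by (intro sum.remove) auto
  then show ?thesis by simp
qed

lemma weight_Suc_le:
  assumes "finite U" "2 \<le> p" shows "p * weight (p ^ Suc L) U \<le> weight (p ^ L) U"
  using unbalanced_class[OF assms(1), of "p ^ L" p] assms(2) by simp

lemma total_weight_Suc_le:
  assumes "2 \<le> p" "\<forall>l<k. finite (U l)"
  shows "p * total_weight k (p ^ Suc L) U \<le> total_weight k (p ^ L) U"
  unfolding total_weight_def sum_distrib_left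
  using assms weight_Suc_le by (intro sum_mono) auto

lemma total_weight_eq_core_size:
  assumes "2 \<le> p" "\<forall>l<k. finite (U l)"
  shows "total_weight k (p ^ L) U = core_size p k U L + p * total_weight k (p ^ Suc L) U"
  using total_weight_Suc_le[OF assms, of L] by (simp add: core_size_def)

lemma reduce_level:
  assumes p: "2 \<le> p" and "\<forall>l<k. finite (U l)" "\<forall>L>j. core_size p k U L < p"
  shows "\<exists>V. (\<forall>l<k. dominated (V l) (U l)) \<and>
    (\<forall>L. core_size p k V L = (if L = j then min (core_size p k U j) (p - 1) else core_size p k U L))"
  using assms(2,3)
proof (induction "core_size p k U j" arbitrary: U rule: less_induct)
  case less
  let ?c = "core_size p k U j"
  let ?w = "\<lambda>L U. total_weight k (p ^ L) U"
  note finU = less.prems(1)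
  show ?case
  proof (cases "?c < p")
    case True
    then show ?thesis using finU p by (intro exI[of _ U]) (auto simp: dominated_refl)
  next
    case False
    have "p * ?w (Suc j) U < ?w j U" using False p by (simp add: core_size_def)
    then have "\<exists>l<k. p * weight (p ^ Suc j) (U l) < weight (p ^ j) (U l)"
      unfolding total_weight_def sum_distrib_left
      by (metis (no_types, lifting) lessThan_iff not_less sum_mono)
    then obtain l where l: "l < k" "p * weight (p ^ Suc j) (U l) < weight (p ^ j) (U l)" by blast
    obtain a where a: "0 < a" and move: "\<And>s. s \<le> a \<Longrightarrow> \<exists>A. dominated A (U l) \<and>
      (\<forall>L\<le>j. weight (p ^ L) A + s * p ^ (j - L) = weight (p ^ L) (U l)) \<and>
      (\<forall>L>j. weight (p ^ L) (U l) \<le> weight (p ^ L) A) \<and>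
      weight (p ^ Suc j) A = weight (p ^ Suc j) (U l) + s * (a - s)"
      using abacus_step[OF _ p l(2)] finU l(1) by blast
    have fam: "\<exists>V. (\<forall>l<k. dominated (V l) (U l)) \<and>
      (\<forall>L\<le>j. ?w L V + s * p ^ (j - L) = ?w L U) \<and>
      (\<forall>L>j. ?w L U \<le> ?w L V) \<and> ?w (Suc j) V = ?w (Suc j) U + s * (a - s)" if s: "s \<le> a" for s
    proof -
      obtain A where A: "dominated A (U l)"
        "\<forall>L\<le>j. weight (p ^ L) A + s * p ^ (j - L) = weight (p ^ L) (U l)"
        "\<forall>L>j. weight (p ^ L) (U l) \<le> weight (p ^ L) A"
        "weight (p ^ Suc j) A = weight (p ^ Suc j) (U l) + s * (a - s)" using move[OF s] by blast
      let ?V = "U(l := A)"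
      have tw: "?w L ?V + weight (p ^ L) (U l) = ?w L U + weight (p ^ L) A" for L
        using total_weight_upd[OF l(1)] by blast
      have "\<forall>i<k. dominated (?V i) (U i)" using A(1) finU by (simp add: dominated_refl)
      moreover have "?w L ?V + s * p ^ (j - L) = ?w L U" if "L \<le> j" for L
      proof -
        have "weight (p ^ L) A + s * p ^ (j - L) = weight (p ^ L) (U l)" using A(2) that by blast
        then show ?thesis using tw[of L] by linarith
      qed
      moreover have "?w L U \<le> ?w L ?V" if "j < L" for L
      proof -
        have "weight (p ^ L) (U l) \<le> weight (p ^ L) A" using A(3) that by blast
        then show ?thesis using tw[of L] by linarith
      qed
      moreover have "?w (Suc j) ?V = ?w (Suc j) U + s * (a - s)" using tw[of "Suc j"] A(4) by linarith
      ultimately show ?thesis by blast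
    qed
    have finV: "\<forall>l<k. finite (V l)" if "\<forall>l<k. dominated (V l) (U l)" for V
      using that by (simp add: dominated_def)
    have wj: "?w j U = ?c + p * ?w (Suc j) U" by (rule total_weight_eq_core_size[OF p finU])
    \<comment> \<open>Otherwise stopping early, at \<open>s < a\<close> beads, would raise the weight at level \<open>j + 1\<close> beyond
      what the weight at level \<open>j\<close> allows.\<close>
    have ac: "a + (p - 1) \<le> ?c"
    proof (rule ccontr)
      assume "\<not> ?thesis"
      moreover define s where "s = ?c - (p - 1)"
      ultimately have s: "0 < s" "s < a" "s + (p - 1) = ?c" using False p by auto
      obtain V where V: "\<forall>l<k. dominated (V l) (U l)" "\<forall>L\<le>j. ?w L V + s * p ^ (j - L) = ?w L U"
        "?w (Suc j) V = ?w (Suc j) U + s * (a - s)" using fam[of s] s by auto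
      have "?w j V + s = ?w j U" using V(2)[rule_format, of j] by simp
      then have "?w j V = p - 1 + p * ?w (Suc j) U" using wj s by linarith
      moreover have "p * ?w (Suc j) V \<le> ?w j V" by (rule total_weight_Suc_le[OF p finV[OF V(1)]])
      moreover have "Suc (?w (Suc j) U) \<le> ?w (Suc j) V" using s V(3) by simp
      then have "p + p * ?w (Suc j) U \<le> p * ?w (Suc j) V"
        using mult_le_mono2[of "Suc (?w (Suc j) U)" _ p] by simp
      ultimately show False using p by linarith
    qed
    obtain V where V: "\<forall>l<k. dominated (V l) (U l)" "\<forall>L\<le>j. ?w L V + a * p ^ (j - L) = ?w L U"
      "\<forall>L>j. ?w L U \<le> ?w L V" "?w (Suc j) V = ?w (Suc j) U" using fam[of a] by auto
    note fV = finV[OF V(1)]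
    \<comment> \<open>Given equality at level \<open>L\<close>, the bound
      \<open>core_size p k U L < p\<close> says that the weight of \<open>U\<close> at level
      \<open>Suc L\<close> is already the largest possible; as the weight of \<open>V\<close> there
      is at least as large, equality propagates upwards.\<close>
    have high: "?w L V = ?w L U" if "Suc j \<le> L" for L
      using that
    proof (induction L rule: dec_induct)
      case base
      then show ?case using V(4) .
    next
      case (step L)
      have "p * ?w (Suc L) V \<le> ?w L V" by (rule total_weight_Suc_le[OF p fV])
      also have "?w L V = core_size p k U L + p * ?w (Suc L) U"
        using step.IH total_weight_eq_core_size[OF p finU] by simp
      also have "\<dots> < p * Suc (?w (Suc L) U)" using less.prems(2) step.hyps by simp
      finally have "?w (Suc L) V \<le> ?w (Suc L) U" by (simp only: nat_mult_less_cancel_disj) simp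
      moreover have "?w (Suc L) U \<le> ?w (Suc L) V" using V(3)[rule_format, of "Suc L"] step.hyps by simp
      ultimately show ?case by (rule le_antisym)
    qed
    have core_high: "core_size p k V L = core_size p k U L" if "j < L" for L
      using high[of L] high[of "Suc L"] that by (simp only: core_size_def)
    \<comment> \<open>The weight at level \<open>L\<close> and \<open>p\<close> times the weight at
      level \<open>Suc L\<close> both drop by \<open>a * p ^ (j - L)\<close>.\<close>
    have core_low: "core_size p k V L = core_size p k U L" if "L < j" for L
    proof -
      have e: "?w L V + a * p ^ (j - L) = ?w L U" "?w (Suc L) V + a * p ^ (j - Suc L) = ?w (Suc L) U"
        using V(2)[rule_format, of L] V(2)[rule_format, of "Suc L"] that by auto
      have "p ^ (j - L) = p * p ^ (j - Suc L)" using that by (metis Suc_diff_Suc power_Suc)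
      then have "?w L V + p * (a * p ^ (j - Suc L)) = ?w L U" using e(1) by (simp only: mult.left_commute)
      moreover have "p * ?w (Suc L) V + p * (a * p ^ (j - Suc L)) = p * ?w (Suc L) U"
        unfolding e(2)[symmetric] by (rule distrib_left[symmetric])
      ultimately show ?thesis unfolding core_size_def by linarith
    qed
    have "?w j V + a = ?w j U" using V(2)[rule_format, of j] by simp
    then have core_j: "core_size p k V j + a = ?c"
      using total_weight_eq_core_size[OF p fV, of j] V(4) wj by simp
    then have "core_size p k V j < ?c" using a by simp
    from less.hyps[OF this fV] less.prems(2) core_high
    obtain W where W: "\<forall>l<k. dominated (W l) (V l)" "\<And>L. core_size p k W L =
       (if L = j then min (core_size p k V j) (p - 1) else core_size p k V L)" by auto
    have "\<forall>l<k. dominated (W l) (U l)" using W(1) V(1) dominated_trans by blast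
    moreover have "core_size p k W L = (if L = j then min ?c (p - 1) else core_size p k U L)" for L
    proof (cases L j rule: linorder_cases)
      \<comment> \<open>By \<open>core_j\<close> and \<open>ac\<close> the value for
        \<open>V\<close> is still at least \<open>p - 1\<close>, so capping it yields the same as
        capping \<open>?c\<close>.\<close>
      case equal
      then show ?thesis using W(2)[of j] core_j ac False by simp
    qed (use W(2)[of L] core_low core_high in auto)
    ultimately show ?thesis by blast
  qed
qed

lemma weight_eq_0:
  assumes "finite U" "\<And>u. u \<in> U \<Longrightarrow> u < m" shows "weight m U = 0"
proof -
  have "{(u, t) \<in> bead_gaps U. m dvd (u - t)} = {}"
    using assms(2) by (fastforce simp: bead_gaps_def dest: dvd_imp_le)
  then show ?thesis by (simp only: weight_def card.empty)
qed

lemma total_weight_eventually_0: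
  assumes "2 \<le> p" "\<forall>l<k. finite (U l)"
  obtains M where "\<And>L. M \<le> L \<Longrightarrow> total_weight k (p ^ L) U = 0"
proof -
  define M where "M = Max (insert 0 (\<Union>l<k. U l))"
  have "total_weight k (p ^ L) U = 0" if "M \<le> L" for L
  proof -
    have "u < p ^ L" if "l < k" "u \<in> U l" for l u
    proof -
      have "u \<le> M" unfolding M_def using that assms by (intro Max_ge) auto
      also have "M \<le> L" by fact
      also have "L < p ^ L" using assms by (intro less_exp[THEN less_le_trans] power_mono) auto
      finally show ?thesis .
    qed
    then show ?thesis using assms weight_eq_0 by (simp add: total_weight_def)
  qed
  then show thesis using that by blast
qed

lemma reduce_all_levels:
  assumes p: "2 \<le> p" and fin: "\<forall>l<k. finite (U l)"
  shows "\<exists>V. (\<forall>l<k. dominated (V l) (U l)) \<and> (\<forall>L. core_size p k V L = min (core_size p k U L) (p - 1))"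
proof -
  obtain M where M: "\<And>L. M \<le> L \<Longrightarrow> total_weight k (p ^ L) U = 0"
    using total_weight_eventually_0[OF assms] by blast
  have "\<exists>V. (\<forall>l<k. dominated (V l) (U l)) \<and> (\<forall>L. core_size p k V L =
     (if j \<le> L then min (core_size p k U L) (p - 1) else core_size p k U L))" if "j \<le> M" for j
    using that
  proof (induction rule: inc_induct)
    case base
    have "core_size p k U L = 0" if "M \<le> L" for L using M[OF that] by (simp add: core_size_def)
    then show ?case using fin by (intro exI[of _ U]) (auto simp: dominated_refl)
  next
    case (step j)
    then obtain V where V: "\<forall>l<k. dominated (V l) (U l)" "\<And>L. core_size p k V L =
     (if Suc j \<le> L then min (core_size p k U L) (p - 1) else core_size p k U L)" by blast
    have "\<forall>l<k. finite (V l)" using V(1) by (simp add: dominated_def)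
    moreover have "\<forall>L>j. core_size p k V L < p" using V(2) p by auto
    ultimately obtain W where W: "\<forall>l<k. dominated (W l) (V l)" "\<And>L. core_size p k W L =
       (if L = j then min (core_size p k V j) (p - 1) else core_size p k V L)"
      using reduce_level[OF p] by blast
    have "\<forall>l<k. dominated (W l) (U l)" using W(1) V(1) dominated_trans by blast
    moreover have "core_size p k W L =
       (if j \<le> L then min (core_size p k U L) (p - 1) else core_size p k U L)" for L
      using W(2) V(2) by auto
    ultimately show ?case by blast
  qed
  from this[of 0] show ?thesis by simp
qed

text \<open>Telescoping of \<open>total_weight_eq_core_size\<close>. Core sizes below
  \<open>p\<close> are therefore base-\<open>p\<close> digits of the number of cells.\<close>

lemma digits_le_total_weight:
  assumes "2 \<le> p" "\<forall>l<k. finite (U l)"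
  shows "(\<Sum>L<M. core_size p k U L * p ^ L) + p ^ M * total_weight k (p ^ M) U = total_weight k 1 U"
proof (induction M)
  case (Suc M)
  have "p ^ M * total_weight k (p ^ M) U
      = core_size p k U M * p ^ M + p ^ Suc M * total_weight k (p ^ Suc M) U"
    by (subst total_weight_eq_core_size[OF assms]) (simp add: algebra_simps)
  then show ?case using Suc.IH by simp
qed simp

text \<open>With all core sizes capped below \<open>p\<close>, each weight is the previous one
  divided by \<open>p\<close>, rounded down. The last part holds because the weight modulo
  \<open>p\<close> is the core size modulo \<open>p\<close>, which is bounded both by the core size
  and by \<open>p - 1\<close>.\<close>

lemma exists_p_reduced:
  assumes p: "2 \<le> p" and fin: "\<forall>l<k. finite (U l)"
  shows "\<exists>V. (\<forall>l<k. dominated (V l) (U l)) \<and>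
    (\<forall>L. total_weight k (p ^ L) V = total_weight k 1 V div p ^ L) \<and>
    (\<Sum>L<M. (total_weight k (p ^ L) U mod p) * p ^ L) \<le> total_weight k 1 V"
proof -
  obtain V where V: "\<forall>l<k. dominated (V l) (U l)"
    "\<And>L. core_size p k V L = min (core_size p k U L) (p - 1)"
    using reduce_all_levels[OF assms] by blast
  have fV: "\<forall>l<k. finite (V l)" using V(1) by (simp add: dominated_def)
  have "total_weight k (p ^ L) V = total_weight k 1 V div p ^ L" for L
  proof (induction L)
    case (Suc L)
    have "total_weight k (p ^ L) V = core_size p k V L + p * total_weight k (p ^ Suc L) V"
      by (rule total_weight_eq_core_size[OF p fV])
    moreover have "core_size p k V L < p" using V(2)[of L] p by simp
    ultimately have "total_weight k (p ^ Suc L) V = total_weight k (p ^ L) V div p" by simp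
    then show ?case using Suc by (simp only: power_Suc2 div_mult2_eq)
  qed simp
  moreover have "(\<Sum>L<M. (total_weight k (p ^ L) U mod p) * p ^ L) \<le> (\<Sum>L<M. core_size p k V L * p ^ L)"
  proof (intro sum_mono mult_right_mono)
    fix L
    have "total_weight k (p ^ L) U mod p = core_size p k U L mod p"
      by (subst total_weight_eq_core_size[OF assms]) simp
    also have "\<dots> \<le> core_size p k V L"
    proof -
      have "core_size p k U L mod p \<le> core_size p k U L" by simp
      moreover have "core_size p k U L mod p < p" using p by simp
      ultimately show ?thesis using V(2)[of L] by simp
    qed
    finally show "total_weight k (p ^ L) U mod p \<le> core_size p k V L" .
  qed simp
  then have "(\<Sum>L<M. (total_weight k (p ^ L) U mod p) * p ^ L) \<le> total_weight k 1 V"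
    using digits_le_total_weight[OF p fV, of M] by linarith
  ultimately show ?thesis using V(1) by blast
qed

section \<open>Diagrams and bead sets\<close>

text \<open>Cell \<open>(i, j)\<close> belongs to the diagram iff the \<open>i\<close>-th largest bead is at least
  \<open>j + card U - i\<close>. The subtraction does not truncate, because the condition forces \<open>i \<le> card U\<close>.\<close>

definition young :: "nat set \<Rightarrow> (nat \<times> nat) set" where
  "young U = {(i, j). 1 \<le> i \<and> 1 \<le> j \<and> i \<le> card {x \<in> U. j + card U - i \<le> x}}"

definition bead_rank :: "nat set \<Rightarrow> nat \<Rightarrow> nat" where
  "bead_rank U u = card {x \<in> U. u \<le> x}"

definition gap_rank :: "nat set \<Rightarrow> nat \<Rightarrow> nat" where
  "gap_rank U t = card {s. s \<le> t \<and> s \<notin> U}"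

text \<open>Beads and gaps are the vertical and horizontal steps of the boundary path of the
  diagram: a bead is a row, counted from the largest bead, and a gap is a column, counted from the
  smallest gap.\<close>

definition cell :: "nat set \<Rightarrow> nat \<times> nat \<Rightarrow> nat \<times> nat" where
  "cell U = (\<lambda>(u, t). (bead_rank U u, gap_rank U t))"

lemma bead_rank_split:
  assumes "finite U" shows "bead_rank U u + card {x \<in> U. x < u} = card U"
proof -
  have "U = {x \<in> U. u \<le> x} \<union> {x \<in> U. x < u}" by auto
  moreover have "card ({x \<in> U. u \<le> x} \<union> {x \<in> U. x < u}) = bead_rank U u + card {x \<in> U. x < u}"
    using assms unfolding bead_rank_def by (intro card_Un_disjoint) auto
  ultimately show ?thesis by simp
qed

lemma gap_rank_split: "gap_rank U t + card {x \<in> U. x \<le> t} = t + 1"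
proof -
  have "{..t} = {s. s \<le> t \<and> s \<notin> U} \<union> {x \<in> U. x \<le> t}" by auto
  moreover have "card ({s. s \<le> t \<and> s \<notin> U} \<union> {x \<in> U. x \<le> t}) = gap_rank U t + card {x \<in> U. x \<le> t}"
    unfolding gap_rank_def by (intro card_Un_disjoint) auto
  ultimately show ?thesis by (metis card_atMost Suc_eq_plus1)
qed

lemma bead_rank_strict:
  assumes "finite U" "u \<in> U" "u < v" shows "bead_rank U v < bead_rank U u"
proof -
  have "{x \<in> U. v \<le> x} \<subseteq> {x \<in> U. u \<le> x}" using assms(3) by auto
  moreover have "u \<in> {x \<in> U. u \<le> x}" "u \<notin> {x \<in> U. v \<le> x}" using assms by auto
  ultimately have "{x \<in> U. v \<le> x} \<subset> {x \<in> U. u \<le> x}" by blast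
  then show ?thesis unfolding bead_rank_def using assms(1) by (simp add: psubset_card_mono)
qed

lemma gap_rank_strict:
  assumes "v \<notin> U" "u < v" shows "gap_rank U u < gap_rank U v"
proof -
  have "{s. s \<le> u \<and> s \<notin> U} \<subseteq> {s. s \<le> v \<and> s \<notin> U}" using assms(2) by auto
  moreover have "v \<in> {s. s \<le> v \<and> s \<notin> U}" "v \<notin> {s. s \<le> u \<and> s \<notin> U}" using assms by auto
  ultimately have "{s. s \<le> u \<and> s \<notin> U} \<subset> {s. s \<le> v \<and> s \<notin> U}" by blast
  then show ?thesis unfolding gap_rank_def by (simp add: psubset_card_mono)
qed

lemma bead_rank_mono: "finite U \<Longrightarrow> u \<le> v \<Longrightarrow> bead_rank U v \<le> bead_rank U u"
  unfolding bead_rank_def by (intro card_mono) auto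

lemma gap_rank_mono: "u \<le> v \<Longrightarrow> gap_rank U u \<le> gap_rank U v"
  unfolding gap_rank_def by (intro card_mono) auto

lemma bead_rank_le_iff:
  assumes "finite U" "u \<in> U" shows "bead_rank U u \<le> bead_rank U v \<longleftrightarrow> v \<le> u"
  using bead_rank_mono[OF assms(1), of v u] bead_rank_strict[OF assms, of v]
  by (cases "v \<le> u") auto

lemma gap_rank_le_iff:
  assumes "t \<notin> U" shows "gap_rank U t \<le> gap_rank U s \<longleftrightarrow> t \<le> s"
  using gap_rank_mono[of t s U] gap_rank_strict[OF assms, of s]
  by (cases "t \<le> s") auto

lemma bead_rank_surj:
  assumes "finite U" "1 \<le> i" "i \<le> card U"
  shows "\<exists>u\<in>U. bead_rank U u = i"
proof -
  have "inj_on (bead_rank U) U"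
    by (rule inj_onI) (metis assms(1) bead_rank_strict less_irrefl linorder_neqE_nat)
  then have "card (bead_rank U ` U) = card {1..card U}" by (simp add: card_image)
  moreover have "bead_rank U u \<in> {1..card U}" if "u \<in> U" for u
  proof -
    have "0 < bead_rank U u" unfolding bead_rank_def using that assms(1)
      by (auto simp: card_gt_0_iff)
    then show ?thesis using bead_rank_split[OF assms(1), of u] by simp
  qed
  then have "bead_rank U ` U \<subseteq> {1..card U}" by blast
  ultimately have "bead_rank U ` U = {1..card U}" by (intro card_subset_eq) auto
  then show ?thesis using assms(2,3) by (metis atLeastAtMost_iff imageE)
qed

lemma gap_rank_surj:
  assumes "1 \<le> j" "j \<le> card {s. s < u \<and> s \<notin> U}"
  shows "\<exists>t<u. t \<notin> U \<and> gap_rank U t = j"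
proof -
  let ?G = "{s. s < u \<and> s \<notin> U}"
  have "inj_on (gap_rank U) ?G"
    by (rule inj_onI) (metis (no_types, lifting) mem_Collect_eq gap_rank_strict less_irrefl linorder_neqE_nat)
  then have "card (gap_rank U ` ?G) = card {1..card ?G}" by (simp add: card_image)
  moreover have "gap_rank U t \<in> {1..card ?G}" if "t \<in> ?G" for t
  proof -
    have "0 < gap_rank U t" unfolding gap_rank_def using that by (auto simp: card_gt_0_iff)
    moreover have "gap_rank U t \<le> card ?G" unfolding gap_rank_def using that by (intro card_mono) auto
    ultimately show ?thesis by simp
  qed
  then have "gap_rank U ` ?G \<subseteq> {1..card ?G}" by blast
  ultimately have "gap_rank U ` ?G = {1..card ?G}" by (intro card_subset_eq) auto
  then have "j \<in> gap_rank U ` ?G" using assms by simp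
  then show ?thesis by blast
qed

lemma gaps_below: "card {s. s < u \<and> s \<notin> U} + card {x \<in> U. x < u} = u"
proof -
  have "{..<u} = {s. s < u \<and> s \<notin> U} \<union> {x \<in> U. x < u}" by auto
  moreover have "card ({s. s < u \<and> s \<notin> U} \<union> {x \<in> U. x < u}) = card {s. s < u \<and> s \<notin> U} + card {x \<in> U. x < u}"
    by (intro card_Un_disjoint) auto
  ultimately show ?thesis by (metis card_lessThan)
qed

text \<open>Below the \<open>i\<close>-th largest bead \<open>u\<close> there are
  \<open>card U - i\<close> beads, hence \<open>u + i - card U\<close> gaps. This number is the
  length of row \<open>i\<close>, and comparing it with \<open>j\<close> is the threshold condition
  in \<open>young\<close>.\<close>

lemma cell_bij:
  assumes fin: "finite U"
  shows "bij_betw (cell U) (bead_gaps U) (young U)"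
proof (rule bij_betw_imageI)
  show "inj_on (cell U) (bead_gaps U)"
  proof (rule inj_onI)
    fix a b assume "a \<in> bead_gaps U" "b \<in> bead_gaps U" "cell U a = cell U b"
    then obtain u t v s where ab: "a = (u, t)" "b = (v, s)" "u \<in> U" "v \<in> U" "t \<notin> U" "s \<notin> U"
      "bead_rank U u = bead_rank U v" "gap_rank U t = gap_rank U s"
      by (auto simp: bead_gaps_def cell_def)
    then have "u = v" by (metis fin bead_rank_strict less_irrefl linorder_neqE_nat)
    moreover have "t = s" using ab by (metis gap_rank_strict less_irrefl linorder_neqE_nat)
    ultimately show "a = b" using ab by simp
  qed
  show "cell U ` bead_gaps U = young U"
  proof (intro equalityI subsetI)
    fix c assume "c \<in> cell U ` bead_gaps U"
    then obtain u t where u: "u \<in> U" "t < u" "t \<notin> U" "c = (bead_rank U u, gap_rank U t)"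
      by (auto simp: bead_gaps_def cell_def)
    have pos: "1 \<le> bead_rank U u" "1 \<le> gap_rank U t"
      using u fin by (auto simp: bead_rank_def gap_rank_def Suc_le_eq card_gt_0_iff)
    have "gap_rank U t \<le> card {s. s < u \<and> s \<notin> U}"
      unfolding gap_rank_def using u by (intro card_mono) auto
    then have "gap_rank U t + card U - bead_rank U u \<le> u"
      using gaps_below[of u U] bead_rank_split[OF fin, of u] by linarith
    then have "bead_rank U u \<le> card {x \<in> U. gap_rank U t + card U - bead_rank U u \<le> x}"
      unfolding bead_rank_def by (intro card_mono) (use fin in auto)
    then show "c \<in> young U" using pos u by (simp add: young_def)
  next
    fix c assume "c \<in> young U"
    then obtain i j where c: "c = (i, j)" "1 \<le> i" "1 \<le> j"
      "i \<le> card {x \<in> U. j + card U - i \<le> x}" by (auto simp: young_def)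
    have "card {x \<in> U. j + card U - i \<le> x} \<le> card U" using fin by (intro card_mono) auto
    then have "i \<le> card U" using c by simp
    then obtain u where u: "u \<in> U" "bead_rank U u = i" using bead_rank_surj[OF fin] c by blast
    have "j + card U - i \<le> u"
    proof (rule ccontr)
      assume "\<not> ?thesis"
      then have "{x \<in> U. j + card U - i \<le> x} \<subset> {x \<in> U. u \<le> x}" using u by auto
      then have "card {x \<in> U. j + card U - i \<le> x} < bead_rank U u"
        unfolding bead_rank_def using fin by (intro psubset_card_mono) auto
      then show False using u c by simp
    qed
    then have "j \<le> card {s. s < u \<and> s \<notin> U}"
      using gaps_below[of u U] bead_rank_split[OF fin, of u] u \<open>i \<le> card U\<close> by linarith
    then obtain t where "t < u" "t \<notin> U" "gap_rank U t = j" using gap_rank_surj c by blast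
    then have "(u, t) \<in> bead_gaps U" "c = cell U (u, t)" using u c by (auto simp: bead_gaps_def cell_def)
    then show "c \<in> cell U ` bead_gaps U" by blast
  qed
qed

lemma finite_young [simp]: "finite U \<Longrightarrow> finite (young U)"
  using cell_bij bij_betw_finite finite_bead_gaps by blast

lemma card_young: "finite U \<Longrightarrow> card (young U) = weight 1 U"
  using bij_betw_same_card[OF cell_bij] by (simp add: weight_def)

text \<open>The cells below the corner of the hook correspond to the beads strictly between
  \<open>t\<close> and \<open>u\<close>, the corner and the cells to its right to the gaps from
  \<open>t\<close> to \<open>u - 1\<close>. Together these are all positions from \<open>t\<close>
  to \<open>u - 1\<close>.\<close>

lemma card_hook:
  assumes fin: "finite U" and ut: "(u, t) \<in> bead_gaps U"
  shows "card (hook (young U) (cell U (u, t))) = u - t"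
proof -
  let ?S = "{(v, s) \<in> bead_gaps U. (v \<le> u \<and> s = t) \<or> (v = u \<and> t \<le> s)}"
  let ?A = "{x \<in> U. t < x \<and> x < u}" and ?B = "{s. s \<notin> U \<and> t \<le> s \<and> s < u}"
  have beads: "u \<in> U" "t \<notin> U" using ut by (auto simp: bead_gaps_def)
  have rank: "bead_rank U u \<le> bead_rank U v \<longleftrightarrow> v \<le> u" for v
    by (rule bead_rank_le_iff[OF fin beads(1)])
  have rank_eq: "bead_rank U v = bead_rank U u \<longleftrightarrow> v = u" if "v \<in> U" for v
    using rank[of v] bead_rank_le_iff[OF fin that, of u] by (auto simp: eq_iff)
  have grank: "gap_rank U t \<le> gap_rank U s \<longleftrightarrow> t \<le> s" for s
    by (rule gap_rank_le_iff[OF beads(2)])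
  have grank_eq: "gap_rank U s = gap_rank U t \<longleftrightarrow> s = t" if "s \<notin> U" for s
    using grank[of s] gap_rank_le_iff[OF that, of t] by (auto simp: eq_iff)
  have "hook (young U) (cell U (u, t)) = cell U ` ?S"
  proof (intro equalityI subsetI)
    fix c assume c: "c \<in> hook (young U) (cell U (u, t))"
    then have "c \<in> cell U ` bead_gaps U"
      using cell_bij[OF fin] by (auto simp: hook_def cell_def bij_betw_def)
    then obtain v s where vs: "(v, s) \<in> bead_gaps U" "c = cell U (v, s)" by auto
    then have "v \<in> U" "s \<notin> U" by (auto simp: bead_gaps_def)
    then have "(v, s) \<in> ?S" using c vs rank rank_eq grank grank_eq by (auto simp: hook_def cell_def)
    then show "c \<in> cell U ` ?S" using vs by blast
  next
    fix c assume "c \<in> cell U ` ?S"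
    then obtain v s where vs: "(v, s) \<in> ?S" "c = cell U (v, s)" by blast
    then have "c \<in> young U" using cell_bij[OF fin] by (auto simp: bij_betw_def)
    moreover have "v \<in> U" "s \<notin> U" using vs by (auto simp: bead_gaps_def)
    ultimately show "c \<in> hook (young U) (cell U (u, t))"
      using vs rank rank_eq grank grank_eq by (auto simp: hook_def cell_def)
  qed
  moreover have "inj_on (cell U) ?S"
    by (rule inj_on_subset[OF bij_betw_imp_inj_on[OF cell_bij[OF fin]]]) auto
  ultimately have "card (hook (young U) (cell U (u, t))) = card ?S" by (simp add: card_image)
  also have "?S = (\<lambda>v. (v, t)) ` ?A \<union> (\<lambda>s. (u, s)) ` ?B"
    using ut by (auto simp: bead_gaps_def le_less)
  also have "card \<dots> = card ?A + card ?B"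
    using fin by (subst card_Un_disjoint) (auto simp: card_image inj_on_def)
  also have "\<dots> = card (?A \<union> ?B)" using fin by (subst card_Un_disjoint) auto
  also have "?A \<union> ?B = {t..<u}" using ut by (auto simp: bead_gaps_def le_less)
  finally show ?thesis by simp
qed

lemma young_move:
  assumes fin: "finite U" and u: "u \<in> U" "1 \<le> u" "u - 1 \<notin> U"
  shows "young (insert (u - 1) (U - {u})) = young U - {cell U (u, u - 1)}"
proof -
  let ?V = "insert (u - 1) (U - {u})"
  have cV: "card ?V = card U" using fin u card.remove[of U u] by simp
  have r: "bead_rank U u + card {x \<in> U. x < u} = card U" by (rule bead_rank_split[OF fin])
  have "{x \<in> U. x \<le> u - 1} = {x \<in> U. x < u}" using u by auto
  then have g: "gap_rank U (u - 1) + card {x \<in> U. x < u} = u"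
    using gap_rank_split[of U "u - 1"] u by simp
  have mem: "(i, j) \<in> young ?V \<longleftrightarrow> (i, j) \<in> young U \<and> (i, j) \<noteq> cell U (u, u - 1)" for i j
  proof (cases "i \<le> card U")
    case False
    have "card {x \<in> W. j + card W - i \<le> x} \<le> card W" if "finite W" for W :: "nat set"
      using that by (intro card_mono) auto
    from this[of U] this[of ?V] False fin cV show ?thesis by (auto simp: young_def)
  next
    case i: True
    \<comment> \<open>Only the count for the threshold \<open>u\<close> changes, and it drops by
      one. This threshold describes one diagonal of the diagram, on which only the cell in row
      \<open>bead_rank U u\<close> is lost.\<close>
    let ?th = "j + card U - i"
    show ?thesis
    proof (cases "?th = u")
      case False
      have "card {x \<in> ?V. ?th \<le> x} = card {x \<in> U. ?th \<le> x}"
      proof (cases "?th < u")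
        case True
        then have "{x \<in> ?V. ?th \<le> x} = insert (u - 1) ({x \<in> U. ?th \<le> x} - {u})"
          using u by auto
        moreover have "card {x \<in> U. ?th \<le> x} = Suc (card ({x \<in> U. ?th \<le> x} - {u}))"
          using True fin u by (intro card.remove) auto
        ultimately show ?thesis using fin u by simp
      next
        case th: False
        then have "{x \<in> ?V. ?th \<le> x} = {x \<in> U. ?th \<le> x}" using u False by auto
        then show ?thesis by simp
      qed
      moreover have "(i, j) \<noteq> cell U (u, u - 1)"
        using False r g i by (auto simp: cell_def)
      ultimately show ?thesis unfolding young_def cV by simp
    next
      case True
      have "{x \<in> ?V. ?th \<le> x} = {x \<in> U. u \<le> x} - {u}" using True u by auto
      then have c: "card {x \<in> ?V. ?th \<le> x} + 1 = bead_rank U u"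
        using fin u card.remove[of "{x \<in> U. u \<le> x}" u] by (simp add: bead_rank_def)
      have "(i, j) = cell U (u, u - 1) \<longleftrightarrow> i = bead_rank U u"
        using True r g i u by (auto simp: cell_def)
      then show ?thesis using c True unfolding young_def cV by (auto simp: bead_rank_def)
    qed
  qed
  then show ?thesis by auto
qed

lemma young_mono:
  assumes "dominated V U" shows "young V \<subseteq> young U"
  using assms by (auto simp: dominated_def young_def intro: le_trans)

section \<open>Bead sets encode exactly the Young diagrams\<close>

lemma downset_eq_interval:
  assumes "finite S" "\<And>x. x \<in> S \<Longrightarrow> 1 \<le> x" "\<And>x y. x \<in> S \<Longrightarrow> 1 \<le> y \<Longrightarrow> y \<le> x \<Longrightarrow> y \<in> S"
  shows "S = {1..card S}"
proof (cases "S = {}")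
  case False
  have "S = {1..Max S}" (is "_ = ?I")
  proof (intro equalityI subsetI)
    fix x assume "x \<in> S"
    then show "x \<in> {1..Max S}" using assms(1) assms(2)[of x] by simp
  next
    fix x assume "x \<in> {1..Max S}"
    then show "x \<in> S" using assms(3)[OF Max_in[OF assms(1) False], of x] by simp
  qed
  moreover from arg_cong[OF this, of card] have "card S = Max S" by simp
  ultimately show ?thesis by simp
qed simp

lemma young_diagram_young:
  assumes fin: "finite U" shows "young_diagram (young U)"
proof -
  let ?Y = "young U"
  have pos: "1 \<le> i \<and> 1 \<le> j" if "(i, j) \<in> ?Y" for i j using that by (simp add: young_def)
  have left: "(i, j') \<in> ?Y" if "(i, j) \<in> ?Y" "1 \<le> j'" "j' \<le> j" for i j j'
  proof -
    have "card {x \<in> U. j + card U - i \<le> x} \<le> card {x \<in> U. j' + card U - i \<le> x}"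
      using that fin by (intro card_mono) auto
    then show ?thesis using that by (auto simp: young_def)
  qed
  have up1: "(i, j) \<in> ?Y" if "(Suc i, j) \<in> ?Y" "1 \<le> i" for i j
  proof -
    \<comment> \<open>The thresholds of neighbouring rows differ by at most 1, so passing from row
      \<open>Suc i\<close> to row \<open>i\<close> loses at most one bead.\<close>
    have "{x \<in> U. j + card U - Suc i \<le> x} \<subseteq> insert (j + card U - Suc i) {x \<in> U. j + card U - i \<le> x}"
      by auto
    then have "card {x \<in> U. j + card U - Suc i \<le> x} \<le> card (insert (j + card U - Suc i) {x \<in> U. j + card U - i \<le> x})"
      using fin by (intro card_mono) auto
    also have "\<dots> \<le> Suc (card {x \<in> U. j + card U - i \<le> x})"
      using fin by (simp add: card_insert_if)
    finally show ?thesis using that by (auto simp: young_def)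
  qed
  have up: "(i', j) \<in> ?Y" if "i' \<le> i" "1 \<le> i'" "(i, j) \<in> ?Y" for i i' j
    using that by (induction i rule: dec_induct) (use up1 in auto)
  define row where "row i = card {j. (i, j) \<in> ?Y}" for i
  define m where "m = card {i. (i, 1) \<in> ?Y}"
  have finrow: "finite {j. (i, j) \<in> ?Y}" for i
    using finite_imageI[OF finite_young[OF fin], of snd] by (rule rev_finite_subset) force
  have fincol: "finite {i. (i, 1) \<in> ?Y}"
    using finite_imageI[OF finite_young[OF fin], of fst] by (rule rev_finite_subset) force
  have R: "{j. (i, j) \<in> ?Y} = {1..row i}" for i
    unfolding row_def using finrow pos left by (intro downset_eq_interval) blast+
  have C: "{i. (i, 1) \<in> ?Y} = {1..m}"
    unfolding m_def using fincol pos up by (intro downset_eq_interval) blast+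
  define lam where "lam = map row [1..<Suc m]"
  have nth: "lam ! i = row (Suc i)" if "i < m" for i using that by (simp add: lam_def del: upt_Suc)
  have len: "length lam = m" by (simp add: lam_def)
  have rowpos: "0 < row i" if "i \<in> {1..m}" for i
  proof -
    have "i \<in> {i. (i, 1) \<in> ?Y}" using that C by (simp only:)
    then have "1 \<in> {j. (i, j) \<in> ?Y}" by (simp only: mem_Collect_eq)
    then have "1 \<in> {1..row i}" by (simp only: R)
    then show ?thesis by simp
  qed
  have rowmono: "row i' \<le> row i" if "1 \<le> i" "i \<le> i'" for i i'
    unfolding row_def using finrow up that by (intro card_mono) auto
  have "is_partition lam"
    unfolding is_partition_def sorted_wrt_iff_nth_less len
  proof (intro conjI allI impI ballI)
    fix i j assume "i < j" "j < m"
    then show "lam ! j \<le> lam ! i" using rowmono by (simp add: nth)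
  next
    fix a assume "a \<in> set lam"
    then show "0 < a" using rowpos by (auto simp: lam_def simp del: upt_Suc)
  qed
  moreover have "?Y = diagram_of lam"
  proof (intro equalityI subsetI)
    fix c assume c: "c \<in> ?Y"
    obtain i j where ij: "c = (i, j)" by (cases c)
    then have "1 \<le> i" "1 \<le> j" using pos c by auto
    moreover have "(i, 1) \<in> ?Y" using left[of i j 1] c ij \<open>1 \<le> j\<close> by simp
    then have "i \<le> m" using C by auto
    moreover have "j \<le> row i" using R[of i] c ij by auto
    ultimately show "c \<in> diagram_of lam" using ij nth[of "i - 1"] len by (simp add: diagram_of_def)
  next
    fix c assume "c \<in> diagram_of lam"
    then obtain i j where ij: "c = (i, j)" "1 \<le> i" "i \<le> m" "1 \<le> j" "j \<le> lam ! (i - 1)"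
      by (auto simp: diagram_of_def len)
    moreover have "lam ! (i - 1) = row i" using nth[of "i - 1"] ij(2,3) by simp
    ultimately have "j \<in> {1..row i}" by simp
    then have "j \<in> {j. (i, j) \<in> ?Y}" by (simp only: R)
    then show "c \<in> ?Y" using ij by simp
  qed
  ultimately show ?thesis unfolding young_diagram_def by blast
qed

lemma young_diagram_obtain:
  assumes "young_diagram Y"
  obtains U where "finite U" "young U = Y"
proof -
  obtain lam where lam: "is_partition lam" "Y = diagram_of lam"
    using assms by (auto simp: young_diagram_def)
  define n where "n = length lam"
  \<comment> \<open>These are the hook lengths in the first column, the classical beta-set with one
    bead per part; rows are indexed from 0 here.\<close>
  define x where "x i = lam ! i + (n - Suc i)" for i
  define U where "U = x ` {..<n}"
  have dec: "x j < x i" if "i < j" "j < n" for i j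
  proof -
    have "lam ! j \<le> lam ! i" using lam(1) that
      by (auto simp: is_partition_def sorted_wrt_iff_nth_less n_def)
    then show ?thesis using that by (simp add: x_def)
  qed
  have inj: "inj_on x {..<n}"
    by (rule inj_onI) (metis dec lessThan_iff less_irrefl linorder_neqE_nat)
  have cU: "card U = n" using inj by (simp add: U_def card_image)
  have finU: "finite U" by (simp add: U_def)
  have "(i, j) \<in> young U \<longleftrightarrow> (i, j) \<in> diagram_of lam" for i j
  proof (cases "1 \<le> i \<and> i \<le> n")
    case False
    have "card {x \<in> U. j + card U - i \<le> x} \<le> card U" using finU by (intro card_mono) auto
    then show ?thesis using False cU by (auto simp: young_def diagram_of_def n_def)
  next
    case True
    let ?th = "j + n - i" and ?k = "i - 1"
    have k: "?k < n" using True by auto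
    have "i \<le> card {x \<in> U. ?th \<le> x} \<longleftrightarrow> ?th \<le> x ?k"
    proof
      assume th: "?th \<le> x ?k"
      have "x ` {..?k} \<subseteq> {x \<in> U. ?th \<le> x}"
      proof
        fix y assume "y \<in> x ` {..?k}"
        then obtain a where a: "a \<le> ?k" "y = x a" by auto
        have "x ?k \<le> x a" using a(1) dec[of a ?k] k by (cases "a = ?k") auto
        then show "y \<in> {x \<in> U. ?th \<le> x}" using a th k by (auto simp: U_def)
      qed
      then have "card (x ` {..?k}) \<le> card {x \<in> U. ?th \<le> x}" using finU by (intro card_mono) auto
      moreover have "inj_on x {..?k}" using k by (intro inj_on_subset[OF inj]) auto
      ultimately show "i \<le> card {x \<in> U. ?th \<le> x}" using True by (simp add: card_image)
    next
      assume le: "i \<le> card {x \<in> U. ?th \<le> x}"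
      show "?th \<le> x ?k"
      proof (rule ccontr)
        assume th: "\<not> ?th \<le> x ?k"
        have "{x \<in> U. ?th \<le> x} \<subseteq> x ` {..<?k}"
        proof
          fix y assume "y \<in> {x \<in> U. ?th \<le> x}"
          then obtain a where a: "a < n" "y = x a" "?th \<le> x a" by (auto simp: U_def)
          then have "x ?k < x a" using th by linarith
          then have "a < ?k" using dec[of ?k a] a(1) by (metis less_asym less_irrefl linorder_neqE_nat)
          then show "y \<in> x ` {..<?k}" using a by blast
        qed
        then have "card {x \<in> U. ?th \<le> x} \<le> card (x ` {..<?k})" by (intro card_mono) auto
        also have "\<dots> \<le> ?k" using card_image_le[of "{..<?k}" x] by simp
        finally have "i \<le> i - 1" using le by (rule le_trans[rotated])
        then show False using True by arith
      qed
    qed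
    moreover have "?th \<le> x ?k \<longleftrightarrow> j \<le> lam ! ?k" using True by (auto simp: x_def)
    ultimately show ?thesis using True cU by (simp add: young_def diagram_of_def n_def)
  qed
  then have "young U = Y" using lam by auto
  then show thesis using that finU by blast
qed

section \<open>Branching of standard tableaux\<close>

text \<open>Standard tableaux are linear extensions of the order of the cells. An arbitrary relation
  on an arbitrary set allows cells to be removed without checking that a diagram remains.\<close>

definition lin_exts :: "('a \<Rightarrow> 'a \<Rightarrow> bool) \<Rightarrow> 'a set \<Rightarrow> ('a \<Rightarrow> nat) set" where
  "lin_exts R P = {T \<in> extensional P. bij_betw T P {1..card P} \<and>
     (\<forall>a\<in>P. \<forall>b\<in>P. R a b \<longrightarrow> T a \<le> T b)}"

lemma finite_lin_exts: assumes "finite P" shows "finite (lin_exts R P)"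
proof (rule finite_subset)
  show "lin_exts R P \<subseteq> P \<rightarrow>\<^sub>E {1..card P}"
    by (auto simp: lin_exts_def PiE_def Pi_def dest: bij_betwE)
  show "finite (P \<rightarrow>\<^sub>E {1..card P})" using assms by (intro finite_PiE) auto
qed

text \<open>Deleting \<open>a\<close> is undone by giving it the value \<open>card P\<close> again;
  the result respects \<open>R\<close>, as nothing but \<open>a\<close> itself lies above
  \<open>a\<close>.\<close>

lemma card_lin_exts_top:
  assumes fin: "finite P" and a: "a \<in> P" "\<And>b. b \<in> P \<Longrightarrow> R a b \<Longrightarrow> b = a"
  shows "card {T \<in> lin_exts R P. T a = card P} = card (lin_exts R (P - {a}))"
proof (rule bij_betw_same_card)
  let ?n = "card P" and ?Q = "P - {a}"
  have cQ: "card ?Q = ?n - 1" "0 < ?n" using a fin by (auto simp: card_gt_0_iff)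
  have iv: "{1..?n} - {?n} = {1..?n - 1}" using cQ by auto
  show "bij_betw (\<lambda>T. restrict T ?Q) {T \<in> lin_exts R P. T a = ?n} (lin_exts R ?Q)"
  proof (rule bij_betw_byWitness[where f' = "\<lambda>S. S(a := ?n)"])
    show "\<forall>T\<in>{T \<in> lin_exts R P. T a = ?n}. (restrict T ?Q)(a := ?n) = T"
    proof
      fix T assume "T \<in> {T \<in> lin_exts R P. T a = ?n}"
      then have "T \<in> extensional P" "T a = ?n" by (auto simp: lin_exts_def)
      then show "(restrict T ?Q)(a := ?n) = T" by (auto simp: fun_eq_iff extensional_def)
    qed
    show "\<forall>S\<in>lin_exts R ?Q. restrict (S(a := ?n)) ?Q = S"
      by (auto simp: lin_exts_def fun_eq_iff extensional_def)
    show "(\<lambda>T. restrict T ?Q) ` {T \<in> lin_exts R P. T a = ?n} \<subseteq> lin_exts R ?Q"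
    proof (rule image_subsetI)
      fix T assume "T \<in> {T \<in> lin_exts R P. T a = ?n}"
      then have T: "bij_betw T P {1..?n}" "T a = ?n" "\<forall>a\<in>P. \<forall>b\<in>P. R a b \<longrightarrow> T a \<le> T b"
        by (auto simp: lin_exts_def)
      have "bij_betw T ?Q {1..?n - 1}"
        using bij_betw_DiffI[OF T(1), of "{a}" "{?n}"] T(2) a(1) cQ(2) unfolding iv
        by (simp add: bij_betw_def)
      then have "bij_betw (restrict T ?Q) ?Q {1..?n - 1}"
        by (rule bij_betw_cong[THEN iffD1, rotated]) simp
      then show "restrict T ?Q \<in> lin_exts R ?Q" using T(3) cQ by (simp add: lin_exts_def)
    qed
    show "(\<lambda>S. S(a := ?n)) ` lin_exts R ?Q \<subseteq> {T \<in> lin_exts R P. T a = ?n}"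
    proof (rule image_subsetI)
      fix S assume S: "S \<in> lin_exts R ?Q"
      let ?T = "S(a := ?n)"
      have bS: "bij_betw S ?Q {1..?n - 1}" using S cQ by (simp add: lin_exts_def)
      have "bij_betw ?T ?Q {1..?n - 1}"
        using bS by (rule bij_betw_cong[THEN iffD1, rotated]) simp
      then have "bij_betw ?T (?Q \<union> {a}) ({1..?n - 1} \<union> {?n})"
        using cQ by (intro bij_betw_combine) (auto simp: bij_betw_def)
      moreover have "?Q \<union> {a} = P" "{1..?n - 1} \<union> {?n} = {1..?n}" using a cQ by auto
      ultimately have "bij_betw ?T P {1..?n}" by simp
      moreover have "?T \<in> extensional P" using S a by (auto simp: lin_exts_def extensional_def)
      moreover have "?T b \<le> ?T c" if "b \<in> P" "c \<in> P" "R b c" for b c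
      proof (cases "b = a \<or> c = a")
        case True
        moreover have "S b \<le> ?n" if "b \<noteq> a"
        proof -
          have "S b \<in> {1..?n - 1}" using bij_betwE[OF bS] that \<open>b \<in> P\<close> by blast
          then have "S b \<le> ?n - 1" by simp
          then show ?thesis by linarith
        qed
        ultimately show ?thesis using a(2) that by auto
      next
        case False
        then show ?thesis using S that by (simp add: lin_exts_def)
      qed
      ultimately show "?T \<in> {T \<in> lin_exts R P. T a = ?n}" by (simp add: lin_exts_def)
    qed
  qed
qed

text \<open>Sort the linear extensions by the element that carries the largest value; by injectivity
  it must be maximal.\<close>

lemma card_lin_exts_rec:
  assumes fin: "finite P" and ne: "P \<noteq> {}"
  shows "card (lin_exts R P) =
    (\<Sum>a | a \<in> P \<and> (\<forall>b\<in>P. R a b \<longrightarrow> b = a). card (lin_exts R (P - {a})))"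
proof -
  let ?n = "card P"
  let ?X = "{a \<in> P. \<forall>b\<in>P. R a b \<longrightarrow> b = a}"
  have n: "1 \<le> ?n" using fin ne by (simp add: Suc_le_eq card_gt_0_iff)
  have "lin_exts R P = (\<Union>a\<in>?X. {T \<in> lin_exts R P. T a = ?n})"
  proof (intro equalityI subsetI)
    fix T assume T: "T \<in> lin_exts R P"
    then have b: "bij_betw T P {1..?n}" by (simp add: lin_exts_def)
    then obtain a where a: "a \<in> P" "T a = ?n"
      using n by (metis atLeastAtMost_iff bij_betw_def imageE order_refl)
    have "c = a" if c: "c \<in> P" "R a c" for c
    proof -
      have "?n \<le> T c" using T a c by (auto simp: lin_exts_def)
      moreover have "T c \<le> ?n" using bij_betwE[OF b] c by fastforce
      ultimately show "c = a" using b a c by (simp add: bij_betw_def inj_on_def)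
    qed
    then show "T \<in> (\<Union>a\<in>?X. {T \<in> lin_exts R P. T a = ?n})" using T a by blast
  qed blast
  moreover have "card (\<Union>a\<in>?X. {T \<in> lin_exts R P. T a = ?n}) = (\<Sum>a\<in>?X. card {T \<in> lin_exts R P. T a = ?n})"
  proof (rule card_UN_disjoint)
    have "a = b" if "a \<in> P" "b \<in> P" "T \<in> lin_exts R P" "T a = ?n" "T b = ?n" for a b T
      using that by (simp add: lin_exts_def bij_betw_def inj_on_def)
    then show "\<forall>a\<in>?X. \<forall>b\<in>?X. a \<noteq> b \<longrightarrow> {T \<in> lin_exts R P. T a = ?n} \<inter> {T \<in> lin_exts R P. T b = ?n} = {}"
      by blast
  qed (use fin in \<open>auto simp: finite_lin_exts\<close>)
  moreover have "(\<Sum>a\<in>?X. card {T \<in> lin_exts R P. T a = ?n}) = (\<Sum>a\<in>?X. card (lin_exts R (P - {a})))"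
    using fin by (intro sum.cong card_lin_exts_top) auto
  ultimately show ?thesis by simp
qed

section \<open>Tableaux of tuples and the removal of corners\<close>

definition cell_le :: "nat \<times> nat \<times> nat \<Rightarrow> nat \<times> nat \<times> nat \<Rightarrow> bool" where
  "cell_le = (\<lambda>(l, i, j) (l', i', j'). l = l' \<and> i \<le> i' \<and> j \<le> j')"

definition cells :: "nat \<Rightarrow> (nat \<Rightarrow> nat set) \<Rightarrow> (nat \<times> nat \<times> nat) set" where
  "cells k U = (SIGMA l:{..<k}. young (U l))"

definition num_tableaux :: "nat \<Rightarrow> (nat \<Rightarrow> nat set) \<Rightarrow> nat" where
  "num_tableaux k U = card (lin_exts cell_le (cells k U))"

definition movable :: "nat set \<Rightarrow> nat set" where
  "movable U = {u \<in> U. 1 \<le> u \<and> u - 1 \<notin> U}"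

lemma movable_bead_gaps: "u \<in> movable U \<Longrightarrow> (u, u - 1) \<in> bead_gaps U"
  by (auto simp: movable_def bead_gaps_def)

lemma finite_cells: "\<forall>l<k. finite (U l) \<Longrightarrow> finite (cells k U)"
  by (auto simp: cells_def)

lemma card_cells: "\<forall>l<k. finite (U l) \<Longrightarrow> card (cells k U) = total_weight k 1 U"
  by (simp add: cells_def total_weight_def card_young)

lemma maximal_cell_iff:
  assumes fin: "finite U" and ut: "(u, t) \<in> bead_gaps U"
  shows "(\<forall>(i, j)\<in>young U. bead_rank U u \<le> i \<and> gap_rank U t \<le> j \<longrightarrow> (i, j) = cell U (u, t))
    \<longleftrightarrow> t = u - 1"
proof -
  have b: "u \<in> U" "t \<notin> U" "t < u" using ut by (auto simp: bead_gaps_def)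
  have inj: "cell U x = cell U y \<longleftrightarrow> x = y" if "x \<in> bead_gaps U" "y \<in> bead_gaps U" for x y
    using bij_betw_imp_inj_on[OF cell_bij[OF fin]] that by (auto simp: inj_on_def)
  have "(\<forall>(i, j)\<in>young U. bead_rank U u \<le> i \<and> gap_rank U t \<le> j \<longrightarrow> (i, j) = cell U (u, t))
    \<longleftrightarrow> (\<forall>x\<in>bead_gaps U. bead_rank U u \<le> fst (cell U x) \<and> gap_rank U t \<le> snd (cell U x) \<longrightarrow> cell U x = cell U (u, t))"
    unfolding bij_betw_imp_surj_on[OF cell_bij[OF fin], symmetric] by (auto simp: case_prod_beta)
  also have "\<dots> \<longleftrightarrow> (\<forall>(v, s)\<in>bead_gaps U. v \<le> u \<and> t \<le> s \<longrightarrow> (v, s) = (u, t))"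
    using inj[OF _ ut] bead_rank_le_iff[OF fin b(1)] gap_rank_le_iff[OF b(2)]
    by (intro ball_cong refl) (auto simp: cell_def split: prod.splits)
  also have "\<dots> \<longleftrightarrow> t = u - 1"
  proof
    assume max: "\<forall>(v, s)\<in>bead_gaps U. v \<le> u \<and> t \<le> s \<longrightarrow> (v, s) = (u, t)"
    show "t = u - 1"
    proof (rule ccontr)
      assume "t \<noteq> u - 1"
      then have "t < u - 1" using b by simp
      \<comment> \<open>The position \<open>u - 1\<close> is a gap or a bead; in either case it
        yields another cell to the right of or below the given one.\<close>
      then have "(u, u - 1) \<in> bead_gaps U \<or> (u - 1, t) \<in> bead_gaps U"
        using b by (auto simp: bead_gaps_def)
      then show False using max \<open>t < u - 1\<close> by auto
    qed
  next
    assume "t = u - 1"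
    then show "\<forall>(v, s)\<in>bead_gaps U. v \<le> u \<and> t \<le> s \<longrightarrow> (v, s) = (u, t)"
      using b by (auto simp: bead_gaps_def)
  qed
  finally show ?thesis .
qed

lemma maximal_cells:
  assumes fin: "\<forall>l<k. finite (U l)"
  shows "{a \<in> cells k U. \<forall>b\<in>cells k U. cell_le a b \<longrightarrow> b = a} =
    (\<lambda>(l, u). (l, cell (U l) (u, u - 1))) ` (SIGMA l:{..<k}. movable (U l))" (is "?L = ?R")
proof (intro equalityI subsetI)
  fix a assume a: "a \<in> ?L"
  then obtain l c where lc: "a = (l, c)" "l < k" "c \<in> young (U l)" by (auto simp: cells_def)
  then obtain u t where ut: "(u, t) \<in> bead_gaps (U l)" "c = cell (U l) (u, t)"
    using bij_betw_imp_surj_on[OF cell_bij[of "U l"]] fin by fast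
  have "\<forall>(i, j)\<in>young (U l). bead_rank (U l) u \<le> i \<and> gap_rank (U l) t \<le> j \<longrightarrow> (i, j) = cell (U l) (u, t)"
  proof clarify
    fix i j assume "(i, j) \<in> young (U l)" "bead_rank (U l) u \<le> i" "gap_rank (U l) t \<le> j"
    then have "(l, i, j) \<in> cells k U" "cell_le a (l, i, j)"
      using lc ut(2) by (simp_all add: cells_def cell_le_def cell_def)
    then have "(l, i, j) = a" using a by blast
    then show "(i, j) = cell (U l) (u, t)" using lc ut(2) by simp
  qed
  then have "t = u - 1" using maximal_cell_iff[OF _ ut(1)] fin lc by blast
  then have "(l, u) \<in> (SIGMA l:{..<k}. movable (U l))" "a = (l, cell (U l) (u, u - 1))"
    using ut lc by (auto simp: bead_gaps_def movable_def)
  then show "a \<in> ?R" by force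
next
  fix a assume "a \<in> ?R"
  then obtain l u where lu: "l < k" "u \<in> movable (U l)" "a = (l, cell (U l) (u, u - 1))" by auto
  note ut = movable_bead_gaps[OF lu(2)]
  have f: "finite (U l)" using fin lu by blast
  have "cell (U l) (u, u - 1) \<in> young (U l)" using cell_bij[OF f] ut by (auto simp: bij_betw_def)
  moreover have "\<forall>(i, j)\<in>young (U l). bead_rank (U l) u \<le> i \<and> gap_rank (U l) (u - 1) \<le> j \<longrightarrow>
      (i, j) = cell (U l) (u, u - 1)"
    using maximal_cell_iff[OF f ut] by blast
  ultimately show "a \<in> ?L" using lu by (auto simp: cells_def cell_le_def cell_def)
qed

lemma cells_upd:
  assumes "l < k" "young A = young (U l) - {c}"
  shows "cells k (U(l := A)) = cells k U - {(l, c)}"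
proof (rule set_eqI)
  fix x :: "nat \<times> nat \<times> nat"
  obtain i d where x: "x = (i, d)" by (cases x)
  show "x \<in> cells k (U(l := A)) \<longleftrightarrow> x \<in> cells k U - {(l, c)}"
    using assms by (cases "i = l") (simp_all add: x cells_def)
qed

lemma num_tableaux_rec:
  assumes fin: "\<forall>l<k. finite (U l)" and pos: "0 < total_weight k 1 U"
  shows "num_tableaux k U =
    (\<Sum>l<k. \<Sum>u\<in>movable (U l). num_tableaux k (U(l := insert (u - 1) (U l - {u}))))"
proof -
  let ?S = "SIGMA l:{..<k}. movable (U l)"
  let ?f = "\<lambda>(l, u). (l, cell (U l) (u, u - 1))"
  have "cells k U \<noteq> {}" using card_cells[OF fin] pos by auto
  then have "num_tableaux k U = (\<Sum>a\<in>?f ` ?S. card (lin_exts cell_le (cells k U - {a})))"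
    unfolding num_tableaux_def maximal_cells[OF fin, symmetric]
    by (rule card_lin_exts_rec[OF finite_cells[OF fin]])
  also have "\<dots> = (\<Sum>x\<in>?S. card (lin_exts cell_le (cells k U - {?f x})))"
  proof (subst sum.reindex)
    show "inj_on ?f ?S"
    proof (rule inj_onI)
      fix x y assume xy: "x \<in> ?S" "y \<in> ?S" "?f x = ?f y"
      obtain l u v where lu: "x = (l, u)" "y = (l, v)" using xy by (cases x, cases y) auto
      have "inj_on (cell (U l)) (bead_gaps (U l))"
        using bij_betw_imp_inj_on[OF cell_bij] fin xy lu by auto
      then have "(u, u - 1) = (v, v - 1)"
        by (rule inj_onD) (use xy lu movable_bead_gaps in auto)
      then show "x = y" using lu by simp
    qed
  qed simp
  also have "\<dots> = (\<Sum>l<k. \<Sum>u\<in>movable (U l). card (lin_exts cell_le (cells k U - {(l, cell (U l) (u, u - 1))})))"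
    using fin by (subst sum.Sigma) (auto simp: movable_def intro!: sum.cong)
  also have "\<dots> = (\<Sum>l<k. \<Sum>u\<in>movable (U l). num_tableaux k (U(l := insert (u - 1) (U l - {u}))))"
  proof (intro sum.cong refl)
    fix l u assume lu: "l \<in> {..<k}" "u \<in> movable (U l)"
    have "young (insert (u - 1) (U l - {u})) = young (U l) - {cell (U l) (u, u - 1)}"
      using fin lu by (intro young_move) (auto simp: movable_def)
    then have "cells k (U(l := insert (u - 1) (U l - {u}))) = cells k U - {(l, cell (U l) (u, u - 1))}"
      using lu by (intro cells_upd) auto
    then show "card (lin_exts cell_le (cells k U - {(l, cell (U l) (u, u - 1))})) =
        num_tableaux k (U(l := insert (u - 1) (U l - {u})))" by (simp add: num_tableaux_def)
  qed
  finally show ?thesis .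
qed

lemma num_tableaux_empty:
  assumes "\<forall>l<k. finite (U l)" "total_weight k 1 U = 0"
  shows "num_tableaux k U = 1"
proof -
  have "cells k U = {}" using card_cells[OF assms(1)] finite_cells[OF assms(1)] assms(2) by simp
  \<comment> \<open>The only function that is extensional on the empty set is
    \<open>undefined\<close> everywhere; it is a bijection onto the empty set
    \<open>{1..0}\<close>.\<close>
  then have "lin_exts cell_le (cells k U) = {\<lambda>x. undefined}"
    by (auto simp: lin_exts_def bij_betw_def)
  then show ?thesis by (simp add: num_tableaux_def)
qed

lemma num_standard_tableaux_eq:
  assumes fin: "\<forall>l<k. finite (U l)"
  defines "Ys \<equiv> map (\<lambda>l. young (U l)) [0..<k]"
  shows "tuple_size Ys = total_weight k 1 U" "num_standard_tableaux Ys = num_tableaux k U"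
proof -
  show sz: "tuple_size Ys = total_weight k 1 U"
    using fin by (simp add: tuple_size_def Ys_def total_weight_def card_young comp_def
        interv_sum_list_conv_sum_set_nat atLeast0LessThan)
  have "tuple_cells Ys = cells k U" by (auto simp: tuple_cells_def cells_def Ys_def)
  then have "standard_tableaux Ys = lin_exts cell_le (cells k U)"
    unfolding standard_tableaux_def lin_exts_def sz card_cells[OF fin]
    by (auto simp: cell_le_def)
  then show "num_standard_tableaux Ys = num_tableaux k U"
    by (simp add: num_standard_tableaux_def num_tableaux_def)
qed

section \<open>The hook length formula\<close>

text \<open>The sums are the coefficients of the expansion at infinity of
  \<open>(\<Prod>y\<in>Y. (z - 1 - y) / (z - y))\<close>; the partial fraction decomposition itself drives the induction.\<close>

lemma partial_fractions:
  fixes Y :: "real set" and R :: "real set \<Rightarrow> real \<Rightarrow> real"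
  assumes "finite Y"
  defines "R \<equiv> \<lambda>Y y. \<Prod>v\<in>Y - {y}. (y - 1 - v) / (y - v)"
  shows "(\<forall>z. z \<notin> Y \<longrightarrow> (\<Prod>y\<in>Y. (z - 1 - y) / (z - y)) = 1 - (\<Sum>y\<in>Y. R Y y / (z - y)))
    \<and> (\<Sum>y\<in>Y. R Y y) = card Y
    \<and> (\<Sum>y\<in>Y. y * R Y y) = \<Sum>Y - real (card Y) * (real (card Y) - 1) / 2"
  using assms(1)
proof (induction Y)
  case empty
  then show ?case by simp
next
  case (insert u Y)
  let ?S = "\<Sum>y\<in>Y. R Y y / (u - y)"
  have ne: "y \<noteq> u" if "y \<in> Y" for y using that insert.hyps by auto
  have Ry: "R (insert u Y) y = R Y y - R Y y / (y - u)" if "y \<in> Y" for y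
  proof -
    have "insert u Y - {y} = insert u (Y - {y})" using ne[OF that] by auto
    then have "R (insert u Y) y = (y - 1 - u) / (y - u) * R Y y"
      using insert.hyps by (simp add: R_def)
    also have "\<dots> = R Y y - R Y y / (y - u)" using ne[OF that] by (simp add: field_simps)
    finally show ?thesis .
  qed
  \<comment> \<open>The new coefficient is the product over \<open>Y\<close> evaluated at
    \<open>z = u\<close>, which the induction hypothesis turns into a sum of the old
    coefficients.\<close>
  have "R (insert u Y) u = (\<Prod>v\<in>Y. (u - 1 - v) / (u - v))" using insert.hyps by (simp add: R_def)
  then have Ru: "R (insert u Y) u = 1 - ?S" using insert by simp
  have neg: "(\<Sum>y\<in>Y. R Y y / (y - u)) = - ?S"
    unfolding sum_negf[symmetric] by (intro sum.cong refl) (metis minus_diff_eq minus_divide_right)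
  have "(\<Prod>y\<in>insert u Y. (z - 1 - y) / (z - y)) = 1 - (\<Sum>y\<in>insert u Y. R (insert u Y) y / (z - y))"
    if z: "z \<notin> insert u Y" for z
  proof -
    let ?Z = "\<Sum>y\<in>Y. R Y y / (z - y)"
    have zu: "z - u \<noteq> 0" using z by auto
    have eq: "R Y y / (y - u) / (z - y) - R Y y / (y - u) / (z - u) = R Y y / (z - y) / (z - u)"
      if "y \<in> Y" for y
    proof -
      have "z - y \<noteq> 0" "y - u \<noteq> 0" using z ne[OF that] that by auto
      then show ?thesis using zu by (simp add: divide_simps) (simp add: algebra_simps)
    qed
    have "(\<Sum>y\<in>Y. R Y y / (y - u) / (z - y)) - (\<Sum>y\<in>Y. R Y y / (y - u) / (z - u)) = ?Z / (z - u)"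
      unfolding sum_subtractf[symmetric] sum_divide_distrib by (intro sum.cong eq refl)
    moreover have "(\<Sum>y\<in>Y. R Y y / (y - u) / (z - u)) = - ?S / (z - u)"
      unfolding neg[symmetric] by (rule sum_divide_distrib[symmetric])
    ultimately have key: "(\<Sum>y\<in>Y. R Y y / (y - u) / (z - y)) = ?Z / (z - u) - ?S / (z - u)" by simp
    have "(\<Sum>y\<in>insert u Y. R (insert u Y) y / (z - y))
        = (1 - ?S) / (z - u) + (\<Sum>y\<in>Y. R Y y / (z - y) - R Y y / (y - u) / (z - y))"
      using insert.hyps Ru Ry by (simp add: diff_divide_distrib)
    also have "\<dots> = (1 - ?S) / (z - u) + ?Z - (?Z / (z - u) - ?S / (z - u))"
      by (simp only: sum_subtractf key add_diff_eq)
    also have "\<dots> = 1 - (z - 1 - u) / (z - u) * (1 - ?Z)"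
    proof -
      have "(z - 1 - u) / (z - u) = 1 - 1 / (z - u)" using zu by (simp add: field_simps)
      moreover have "(1 - s) / w + t - (t / w - s / w) = 1 - (1 - 1 / w) * (1 - t)" for s t w :: real
        by (simp add: diff_divide_distrib algebra_simps)
      ultimately show ?thesis by (simp only:)
    qed
    finally show ?thesis using insert z by simp
  qed
  moreover have "(\<Sum>y\<in>insert u Y. R (insert u Y) y) = card (insert u Y)"
    using insert Ru Ry neg by (simp add: sum_subtractf)
  moreover have "(\<Sum>y\<in>insert u Y. y * R (insert u Y) y)
      = \<Sum>(insert u Y) - real (card (insert u Y)) * (real (card (insert u Y)) - 1) / 2"
  proof -
    have "y * R (insert u Y) y = y * R Y y - R Y y + u * (R Y y / (u - y))" if "y \<in> Y" for y
    proof -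
      have "y - u \<noteq> 0" "u - y \<noteq> 0" using ne[OF that] by auto
      then show ?thesis unfolding Ry[OF that] by (simp add: divide_simps) (simp add: algebra_simps)
    qed
    then have "(\<Sum>y\<in>Y. y * R (insert u Y) y) = (\<Sum>y\<in>Y. y * R Y y) - (\<Sum>y\<in>Y. R Y y) + u * ?S"
      by (simp add: sum.distrib sum_subtractf sum_distrib_left)
    moreover have "u * R (insert u Y) u = u - u * ?S" unfolding Ru by (simp add: algebra_simps)
    ultimately show ?thesis using insert by (simp add: field_simps)
  qed
  ultimately show ?case by blast
qed

section \<open>Hook products and their change when a corner is removed\<close>

definition hook_product :: "nat set \<Rightarrow> nat" where
  "hook_product U = (\<Prod>(u, t)\<in>bead_gaps U. u - t)"

definition pair_product :: "nat set \<Rightarrow> nat" where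
  "pair_product U = (\<Prod>(u, t)\<in>bead_pairs 1 U. u - t)"

lemma prod_diff_fact: "(\<Prod>t<u. u - t) = (fact u :: nat)"
proof -
  have "(\<Prod>t<u. u - t) = (\<Prod>i\<in>{1..u}. i)"
    by (rule prod.reindex_bij_witness[of _ "\<lambda>i. u - i" "\<lambda>t. u - t"]) auto
  then show ?thesis by (simp add: fact_prod)
qed

text \<open>For a bead \<open>u\<close>, the differences \<open>u - t\<close> over all
  \<open>t < u\<close> multiply to \<open>fact u\<close>; \<open>t\<close> is a gap, giving a hook
  length, or a bead. This links the hook product with Frobenius' formula in terms of differences of
  beta-numbers.\<close>

lemma hook_product_pair_product:
  assumes "finite U"
  shows "hook_product U * pair_product U = (\<Prod>u\<in>U. fact u)"
proof -
  have "bead_gaps U \<inter> bead_pairs 1 U = {}" by (auto simp: bead_gaps_def bead_pairs_def)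
  then have "hook_product U * pair_product U = (\<Prod>(u, t)\<in>bead_gaps U \<union> bead_pairs 1 U. u - t)"
    using assms by (simp add: hook_product_def pair_product_def prod.union_disjoint)
  also have "bead_gaps U \<union> bead_pairs 1 U = (SIGMA u:U. {..<u})"
    by (auto simp: bead_gaps_def bead_pairs_def)
  also have "(\<Prod>(u, t)\<in>(SIGMA u:U. {..<u}). u - t) = (\<Prod>u\<in>U. \<Prod>t<u. u - t)"
    using assms by (simp add: prod.Sigma)
  finally show ?thesis by (simp add: prod_diff_fact)
qed

lemma pair_product_insert:
  assumes "finite V" "x \<notin> V"
  shows "real (pair_product (insert x V)) = real (pair_product V) * (\<Prod>v\<in>V. \<bar>real x - real v\<bar>)"
proof -
  let ?f = "\<lambda>y. (max x y, min x y)"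
  have "cls 1 x V = V" by (auto simp: cls_def)
  then have "bead_pairs 1 (insert x V) = bead_pairs 1 V \<union> ?f ` V"
    using bead_pairs_insert[OF assms(2), of 1] by simp
  then have "pair_product (insert x V) = pair_product V * (\<Prod>v\<in>V. max x v - min x v)"
    using assms bead_pairs_insert_disjoint[OF assms(2), of 1 V]
    by (simp add: pair_product_def prod.union_disjoint
        prod.reindex[OF inj_on_subset[OF inj_max_min]])
  moreover have "real (max x v - min x v) = \<bar>real x - real v\<bar>" for v
    by (cases "x \<le> v") (auto simp: of_nat_diff)
  ultimately show ?thesis by simp
qed

lemma hook_product_pos: "finite U \<Longrightarrow> 0 < hook_product U"
  by (auto simp: hook_product_def bead_gaps_def intro!: prod_pos)

lemma pair_product_pos: "finite U \<Longrightarrow> 0 < pair_product U"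
  by (auto simp: pair_product_def bead_pairs_def intro!: prod_pos)

text \<open>Both bead sets share \<open>U - {u}\<close>. In \<open>hook_product_pair_product\<close>
  the factorials contribute the factor \<open>u\<close>, and the pair products differ only in the
  distances from the moving bead to the others.\<close>

lemma hook_product_move:
  assumes fin: "finite U" and u: "u \<in> movable U"
  shows "real (hook_product U) / real (hook_product (insert (u - 1) (U - {u})))
    = real u * (\<Prod>v\<in>U - {u}. (real u - 1 - real v) / (real u - real v))"
proof -
  let ?V = "U - {u}" and ?U' = "insert (u - 1) (U - {u})"
  let ?P = "\<lambda>x. \<Prod>v\<in>?V. \<bar>real x - real v\<bar>"
  have u': "u \<in> U" "1 \<le> u" "u - 1 \<notin> U" using u by (auto simp: movable_def)
  have ins: "insert u ?V = U" using u' by auto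
  have finV: "finite ?V" "finite ?U'" using fin by auto
  have "real (hook_product U) * real (pair_product U) = fact u * real (\<Prod>v\<in>?V. fact v)"
    using arg_cong[OF hook_product_pair_product[OF fin], of real]
    by (simp add: prod.remove[OF fin u'(1)])
  then have 1: "real (hook_product U) * (real (pair_product ?V) * ?P u) = fact u * real (\<Prod>v\<in>?V. fact v)"
    using pair_product_insert[OF finV(1), of u] ins by simp
  have "real (hook_product ?U') * real (pair_product ?U') = fact (u - 1) * real (\<Prod>v\<in>?V. fact v)"
    using arg_cong[OF hook_product_pair_product[OF finV(2)], of real] u' finV by simp
  then have 2: "real (hook_product ?U') * (real (pair_product ?V) * ?P (u - 1)) = fact (u - 1) * real (\<Prod>v\<in>?V. fact v)"
    using pair_product_insert[OF finV(1), of "u - 1"] u' by simp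
  have P: "0 < ?P x" if "x \<notin> ?V" for x
    by (intro prod_pos) (use that in auto)
  have pos: "0 < real (hook_product ?U')" "0 < real (pair_product ?V)" "0 < ?P u" "0 < ?P (u - 1)"
    using hook_product_pos[OF finV(2)] pair_product_pos[OF finV(1)] P[of u] P[of "u - 1"] u'
    by simp_all
  have "fact u = real u * fact (u - 1)" using u' by (simp add: fact_reduce)
  then have "real (hook_product U) * (real (pair_product ?V) * ?P u)
     = real u * (real (hook_product ?U') * (real (pair_product ?V) * ?P (u - 1)))"
    unfolding 1 2 by simp
  then have "real (hook_product U) / real (hook_product ?U') = real u * (?P (u - 1) / ?P u)"
    using pos by (simp add: field_simps)
  also have "?P (u - 1) / ?P u = (\<Prod>v\<in>?V. (real u - 1 - real v) / (real u - real v))"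
    unfolding prod_dividef[symmetric]
  proof (rule prod.cong[OF refl])
    fix v assume "v \<in> ?V"
    then have "v \<noteq> u" "v \<noteq> u - 1" using u' by auto
    then have "v < u - 1 \<or> u < v" by auto
    then show "\<bar>real (u - 1) - real v\<bar> / \<bar>real u - real v\<bar> = (real u - 1 - real v) / (real u - real v)"
    proof
      assume "v < u - 1"
      then show ?thesis using u' by (simp add: of_nat_diff)
    next
      assume "u < v"
      then have "\<bar>real (u - 1) - real v\<bar> = - (real u - 1 - real v)" "\<bar>real u - real v\<bar> = - (real u - real v)"
        using u' by (auto simp: of_nat_diff)
      then show ?thesis by (simp only: minus_divide_divide)
    qed
  qed
  finally show ?thesis .
qed

lemma card_bead_pairs_1:
  assumes "finite U"
  shows "2 * card (bead_pairs 1 U) = card U * (card U - 1)"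
  using assms
proof (induction U)
  case empty
  then show ?case by (simp add: bead_pairs_def)
next
  case (insert x U)
  have "cls 1 x U = U" by (auto simp: cls_def)
  then have "card (bead_pairs 1 (insert x U)) = card (bead_pairs 1 U) + card U"
    using card_bead_pairs_insert[OF insert.hyps, of 1] by simp
  then show ?case using insert by (cases "card U") auto
qed

text \<open>Extended to all beads, the sum is the first moment in \<open>partial_fractions\<close>:
  the sum of the beads minus the number of pairs of beads. By \<open>weight_plus_pairs\<close> with
  modulus 1 this is the number of cells.\<close>

lemma sum_hook_ratio:
  assumes fin: "finite U"
  shows "(\<Sum>u\<in>movable U. real (hook_product U) / real (hook_product (insert (u - 1) (U - {u}))))
    = real (weight 1 U)"
proof -
  let ?R = "\<lambda>u. \<Prod>v\<in>U - {u}. (real u - 1 - real v) / (real u - real v)"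
  have "(\<Sum>u\<in>movable U. real (hook_product U) / real (hook_product (insert (u - 1) (U - {u}))))
    = (\<Sum>u\<in>movable U. real u * ?R u)"
    by (intro sum.cong refl hook_product_move fin)
  also have "\<dots> = (\<Sum>u\<in>U. real u * ?R u)"
  proof (rule sum.mono_neutral_left[OF fin])
    show "movable U \<subseteq> U" by (auto simp: movable_def)
    \<comment> \<open>A bead that cannot be lowered by 1 is 0, where the factor \<open>u\<close>
      vanishes, or has a bead \<open>v = u - 1\<close> below it, where the factor for
      \<open>v\<close> vanishes.\<close>
    show "\<forall>u\<in>U - movable U. real u * ?R u = 0"
    proof
      fix u assume "u \<in> U - movable U"
      then have "u = 0 \<or> 1 \<le> u \<and> u - 1 \<in> U - {u}" by (auto simp: movable_def)
      then show "real u * ?R u = 0"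
      proof
        assume u: "1 \<le> u \<and> u - 1 \<in> U - {u}"
        then have "?R u = 0" using fin by (intro prod_zero) (auto intro!: bexI[of _ "u - 1"] simp: of_nat_diff)
        then show ?thesis by simp
      qed simp
    qed
  qed
  also have "\<dots> = (\<Sum>y\<in>real ` U. y * (\<Prod>v\<in>real ` U - {y}. (y - 1 - v) / (y - v)))"
  proof -
    have "(\<Prod>v\<in>real ` U - {real u}. (real u - 1 - v) / (real u - v)) = ?R u" for u
    proof -
      have "real ` U - {real u} = real ` (U - {u})" by auto
      then show ?thesis by (simp add: prod.reindex inj_on_def)
    qed
    then show ?thesis by (simp add: sum.reindex inj_on_def)
  qed
  also have "\<dots> = \<Sum>(real ` U) - real (card (real ` U)) * (real (card (real ` U)) - 1) / 2"
    using partial_fractions[of "real ` U"] fin by auto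
  also have "\<dots> = (\<Sum>u\<in>U. real u) - real (card (bead_pairs 1 U))"
  proof -
    have "real (2 * card (bead_pairs 1 U)) = real (card U * (card U - 1))"
      by (simp only: card_bead_pairs_1[OF fin])
    then have "real (card U) * (real (card U) - 1) / 2 = real (card (bead_pairs 1 U))"
      by (cases "card U") (auto simp: algebra_simps)
    then show ?thesis by (simp add: sum.reindex card_image inj_on_def)
  qed
  also have "\<dots> = real (weight 1 U)"
    using arg_cong[OF weight_plus_pairs[OF fin, of 1], of real] by simp
  finally show ?thesis .
qed

lemma weight_move_1:
  assumes "finite U" "u \<in> movable U"
  shows "weight 1 (insert (u - 1) (U - {u})) + 1 = weight 1 U"
  using weight_move_multiple[of U 1 u 1] assms by (auto simp: movable_def)

text \<open>Multiply the branching rule by the hook product. Removing a corner alters the hook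
  product of one component only, so by \<open>sum_hook_ratio\<close> each component contributes its
  own size times the factorial for one cell less; the sizes add up to the missing factor.\<close>

lemma hook_length_formula:
  assumes "\<forall>l<k. finite (U l)"
  shows "num_tableaux k U * (\<Prod>l<k. hook_product (U l)) = fact (total_weight k 1 U)"
  using assms
proof (induction "total_weight k 1 U" arbitrary: U)
  case 0
  have "hook_product (U l) = 1" if "l < k" for l
  proof -
    have "weight 1 (U l) = 0" using 0(1) that by (simp add: total_weight_def)
    then have "bead_gaps (U l) = {}" using 0(2) that by (simp add: weight_def)
    then show ?thesis by (simp add: hook_product_def)
  qed
  then show ?case using num_tableaux_empty[OF 0(2)] 0(1) by simp
next
  case (Suc n)
  let ?H = "\<lambda>U. \<Prod>l<k. real (hook_product (U l))"
  let ?m = "\<lambda>l u. insert (u - 1) (U l - {u})"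
  have Hpos: "0 < ?H U" using Suc.prems by (auto intro!: prod_pos simp: hook_product_pos)
  have step: "real (num_tableaux k (U(l := ?m l u))) * ?H U
      = fact n * (real (hook_product (U l)) / real (hook_product (?m l u)))"
    if l: "l < k" and u: "u \<in> movable (U l)" for l u
  proof -
    let ?U' = "U(l := ?m l u)"
    have fl: "finite (U l)" using Suc.prems l by blast
    have fin: "\<forall>i<k. finite (?U' i)" using Suc.prems by simp
    have "total_weight k 1 ?U' + 1 = total_weight k 1 U"
      using total_weight_upd[OF l, of 1 U "?m l u"] weight_move_1[OF fl u] by simp
    then have tw: "n = total_weight k 1 ?U'" using Suc.hyps(2) by simp
    have eq: "real (num_tableaux k W) * ?H W = fact n"
      if "num_tableaux k W * (\<Prod>l<k. hook_product (W l)) = fact n" for W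
      using arg_cong[OF that, of real] by simp
    have "real (num_tableaux k ?U') * ?H ?U' = fact n"
      by (rule eq) (use Suc.hyps(1)[OF tw fin] in \<open>simp only: tw\<close>)
    moreover have "?H W = real (hook_product (W l)) * (\<Prod>i\<in>{..<k} - {l}. real (hook_product (W i)))" for W
      using l by (intro prod.remove) auto
    then have "?H ?U' * real (hook_product (U l)) = ?H U * real (hook_product (?m l u))" by simp
    moreover have "0 < real (hook_product (?m l u))" using hook_product_pos fl by simp
    moreover have "N * H = f * (h / h')" if "N * H' = f" "H' * h = H * h'" "0 < h'" for N H H' f h h' :: real
      using that by (simp add: field_simps flip: that(1))
    ultimately show ?thesis by blast
  qed
  have "real (num_tableaux k U) * ?H U
      = (\<Sum>l<k. \<Sum>u\<in>movable (U l). real (num_tableaux k (U(l := ?m l u))) * ?H U)"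
    using num_tableaux_rec[OF Suc.prems] Suc.hyps(2) by (simp add: sum_distrib_right)
  also have "\<dots> = (\<Sum>l<k. \<Sum>u\<in>movable (U l). fact n * (real (hook_product (U l)) / real (hook_product (?m l u))))"
    using step by (intro sum.cong refl) auto
  also have "\<dots> = (\<Sum>l<k. fact n * real (weight 1 (U l)))"
    unfolding sum_distrib_left[symmetric] using sum_hook_ratio Suc.prems by simp
  also have "\<dots> = fact n * real (Suc n)"
    using Suc.hyps(2) unfolding sum_distrib_left[symmetric] by (simp add: total_weight_def flip: of_nat_sum)
  also have "\<dots> = real (fact (total_weight k 1 U))" using Suc.hyps(2)[symmetric] by (simp add: algebra_simps)
  finally have "real (num_tableaux k U * (\<Prod>l<k. hook_product (U l))) = real (fact (total_weight k 1 U))" by simp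
  then show ?case by (simp only: of_nat_eq_iff)
qed

section \<open>Divisibility by p\<close>

lemma card_prime_power_dvd:
  fixes n p :: nat
  assumes "prime p" "0 < n" "n \<le> M"
  shows "card {L \<in> {1..M}. p ^ L dvd n} = multiplicity p n"
proof -
  have p: "\<not> is_unit p" "2 \<le> p" using assms(1) by (auto simp: prime_ge_2_nat)
  \<comment> \<open>This shows that the range up to \<open>M\<close> is long enough: the
    multiplicity is less than \<open>n\<close>.\<close>
  have "multiplicity p n < p ^ multiplicity p n"
    using p(2) by (intro less_exp[THEN less_le_trans] power_mono) auto
  also have "\<dots> \<le> n" using assms(2) by (intro dvd_imp_le multiplicity_dvd) auto
  finally have "{L \<in> {1..M}. p ^ L dvd n} = {1..multiplicity p n}"
    using assms p by (auto simp: power_dvd_iff_le_multiplicity)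
  then show ?thesis by simp
qed

lemma multiplicity_prod_eq:
  fixes g :: "'a \<Rightarrow> nat"
  assumes p: "prime p" and fin: "finite I" and g: "\<And>i. i \<in> I \<Longrightarrow> 0 < g i \<and> g i \<le> M"
  shows "multiplicity p (\<Prod>i\<in>I. g i) = (\<Sum>L\<in>{1..M}. card {i \<in> I. p ^ L dvd g i})"
proof -
  have "multiplicity p (\<Prod>i\<in>I. g i) = (\<Sum>i\<in>I. multiplicity p (g i))"
    using p fin g by (intro prime_elem_multiplicity_prod_distrib) (auto simp: image_iff)
  also have "\<dots> = (\<Sum>i\<in>I. \<Sum>L\<in>{1..M}. of_bool (p ^ L dvd g i))"
    using card_prime_power_dvd[OF p] g by (intro sum.cong refl) (simp add: Int_def)
  also have "\<dots> = (\<Sum>L\<in>{1..M}. \<Sum>i\<in>I. of_bool (p ^ L dvd g i))" by (rule sum.swap)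
  also have "\<dots> = (\<Sum>L\<in>{1..M}. card {i \<in> I. p ^ L dvd g i})"
    using fin by (simp add: Int_def)
  finally show ?thesis .
qed

text \<open>Legendre's formula, with the factorial written as the product of \<open>n - t\<close>
  over \<open>t < n\<close>, so that \<open>card_multiples_below\<close> counts the divisible
  factors.\<close>

lemma multiplicity_fact_eq:
  assumes "prime p" "n \<le> M"
  shows "multiplicity p (fact n :: nat) = (\<Sum>L\<in>{1..M}. n div p ^ L)"
proof -
  have "multiplicity p (fact n :: nat) = (\<Sum>L\<in>{1..M}. card {t \<in> {..<n}. p ^ L dvd (n - t)})"
    unfolding prod_diff_fact[symmetric] using assms by (intro multiplicity_prod_eq) auto
  also have "\<dots> = (\<Sum>L\<in>{1..M}. n div p ^ L)"
    using card_multiples_below[of "p ^ _" n] prime_gt_0_nat[OF assms(1)] by (intro sum.cong refl) simp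
  finally show ?thesis .
qed

lemma multiplicity_hook_product:
  assumes "prime p" "finite U" "\<And>u. u \<in> U \<Longrightarrow> u \<le> M"
  shows "multiplicity p (hook_product U) = (\<Sum>L\<in>{1..M}. weight (p ^ L) U)"
proof -
  have "hook_product U = (\<Prod>x\<in>bead_gaps U. fst x - snd x)"
    by (simp add: hook_product_def case_prod_beta)
  also have "multiplicity p \<dots> = (\<Sum>L\<in>{1..M}. card {x \<in> bead_gaps U. p ^ L dvd fst x - snd x})"
  proof (rule multiplicity_prod_eq[OF assms(1)])
    fix x assume "x \<in> bead_gaps U"
    then show "0 < fst x - snd x \<and> fst x - snd x \<le> M"
      using assms(3)[of "fst x"] by (auto simp: bead_gaps_def)
  qed (use assms in simp)
  also have "\<dots> = (\<Sum>L\<in>{1..M}. weight (p ^ L) U)"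
    unfolding weight_def by (intro sum.cong refl arg_cong[where f = card]) auto
  finally show ?thesis .
qed

lemma num_tableaux_coprime:
  assumes p: "prime p" and fin: "\<forall>l<k. finite (U l)"
    and w: "\<And>L. total_weight k (p ^ L) U = total_weight k 1 U div p ^ L"
  shows "\<not> p dvd num_tableaux k U"
proof
  assume dvd: "p dvd num_tableaux k U"
  let ?N = "total_weight k 1 U"
  \<comment> \<open>A common bound for the number of cells and for all beads, hence for all hook
    lengths, so that every multiplicity is a sum over the same levels.\<close>
  define M where "M = ?N + (\<Sum>l<k. \<Sum>(U l))"
  have le: "u \<le> M" if "l < k" "u \<in> U l" for l u
  proof -
    have "u \<le> \<Sum>(U l)" using that fin by (intro member_le_sum) auto
    also have "\<dots> \<le> (\<Sum>l<k. \<Sum>(U l))"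
      using that member_le_sum[of l "{..<k}" "\<lambda>l. \<Sum>(U l)"] by simp
    finally show ?thesis by (simp add: M_def)
  qed
  let ?H = "\<Prod>l<k. hook_product (U l)"
  have H: "?H \<noteq> 0" using fin hook_product_pos by (auto simp: prod_zero_iff)
  have f: "num_tableaux k U * ?H = fact ?N" by (rule hook_length_formula[OF fin])
  then have ne: "num_tableaux k U \<noteq> 0" by (metis fact_nonzero mult_zero_left)
  have "multiplicity p ?H = (\<Sum>l<k. multiplicity p (hook_product (U l)))"
  proof (rule prime_elem_multiplicity_prod_distrib)
    have "hook_product (U l) \<noteq> 0" if "l < k" for l
      using hook_product_pos[of "U l"] fin that by simp
    then show "0 \<notin> (\<lambda>l. hook_product (U l)) ` {..<k}" by (metis imageE lessThan_iff)
  qed (use p in auto)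
  also have "\<dots> = (\<Sum>l<k. \<Sum>L\<in>{1..M}. weight (p ^ L) (U l))"
    using multiplicity_hook_product[OF p] fin le by (intro sum.cong refl) auto
  also have "\<dots> = (\<Sum>L\<in>{1..M}. total_weight k (p ^ L) U)"
    unfolding total_weight_def by (rule sum.swap)
  also have "\<dots> = multiplicity p (fact ?N :: nat)"
    using multiplicity_fact_eq[OF p, of ?N M] by (simp add: w M_def)
  also have "\<dots> = multiplicity p (num_tableaux k U) + multiplicity p ?H"
    unfolding f[symmetric] using p ne H by (intro prime_elem_multiplicity_mult_distrib) auto
  finally have "multiplicity p (num_tableaux k U) = 0" by simp
  then show False using dvd ne p by (metis multiplicity_eq_zero_iff not_prime_unit)
qed

lemma descend:
  assumes "\<forall>l<k. finite (U l)" "\<not> p dvd num_tableaux k U" "m \<le> total_weight k 1 U"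
  shows "\<exists>V. (\<forall>l<k. dominated (V l) (U l)) \<and> total_weight k 1 V = m \<and> \<not> p dvd num_tableaux k V"
  using assms
proof (induction "total_weight k 1 U" arbitrary: U rule: less_induct)
  case less
  show ?case
  proof (cases "m = total_weight k 1 U")
    case True
    then show ?thesis using less.prems by (intro exI[of _ U]) (auto simp: dominated_refl)
  next
    case False
    let ?m = "\<lambda>l u. insert (u - 1) (U l - {u})"
    have "0 < total_weight k 1 U" using False less.prems by simp
    from num_tableaux_rec[OF less.prems(1) this] less.prems(2)
    obtain l where l: "l < k" "\<not> p dvd (\<Sum>u\<in>movable (U l). num_tableaux k (U(l := ?m l u)))"
      by (metis (no_types, lifting) dvd_sum lessThan_iff)
    then obtain u where u: "u \<in> movable (U l)" "\<not> p dvd num_tableaux k (U(l := ?m l u))"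
      by (meson dvd_sum)
    define W where "W = U(l := ?m l u)"
    have fl: "finite (U l)" using less.prems l by blast
    have "dominated (?m l u) (U l)" using u fl by (intro dominated_move) (auto simp: movable_def)
    then have dom: "\<forall>i<k. dominated (W i) (U i)" using less.prems by (simp add: W_def dominated_refl)
    have "total_weight k 1 W + 1 = total_weight k 1 U"
      using total_weight_upd[OF l(1), of 1 U "?m l u"] weight_move_1[OF fl u(1)] unfolding W_def by linarith
    then have tw: "total_weight k 1 W < total_weight k 1 U" "m \<le> total_weight k 1 W"
      using False less.prems by auto
    have "\<forall>i<k. finite (W i)" using dom by (simp add: dominated_def)
    from less.hyps[OF tw(1) this] u(2) tw(2) obtain V where
      "\<forall>l<k. dominated (V l) (W l)" "total_weight k 1 V = m" "\<not> p dvd num_tableaux k V"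
      unfolding W_def by blast
    then show ?thesis using dom dominated_trans by blast
  qed
qed

section \<open>From hook lengths to the Nim-sum\<close>

lemma sum_mset_sum_list:
  "(\<Sum>n\<in>#(\<Sum>y\<leftarrow>ys. F y). g n) = (\<Sum>y\<leftarrow>ys. \<Sum>n\<in>#F y. (g n :: nat))"
  by (induction ys) auto

text \<open>By definition \<open>pi_nim p h\<close> has the digit 1 at the positions up to the
  multiplicity of \<open>p\<close> in \<open>h\<close> and 0 above; the digit 1 is admissible
  because \<open>p\<close> is at least 2.\<close>

lemma digit_pi_nim:
  assumes "prime p" "0 < h"
  shows "digit p (pi_nim p h) L = of_bool (p ^ L dvd h)"
proof -
  have "digit p (\<Sum>L<Suc (multiplicity p h). 1 * p ^ L) L = (if L < Suc (multiplicity p h) then 1 else 0)"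
    using digit_sum[where p = p and d = "\<lambda>_. 1" and m = "Suc (multiplicity p h)" and K = L]
      prime_ge_2_nat[OF assms(1)] by (simp del: sum.lessThan_Suc)
  moreover have "{0..multiplicity p h} = {..<Suc (multiplicity p h)}" by auto
  moreover have "p ^ L dvd h \<longleftrightarrow> L < Suc (multiplicity p h)"
    using assms not_prime_unit[of p] by (subst power_dvd_iff_le_multiplicity) auto
  ultimately show ?thesis by (simp add: pi_nim_def del: sum.lessThan_Suc)
qed

lemma hook_lengths_young:
  assumes "finite U"
  shows "image_mset (\<lambda>c. card (hook (young U) c)) (mset_set (young U)) =
    image_mset (\<lambda>x. fst x - snd x) (mset_set (bead_gaps U))"
proof -
  have b: "inj_on (cell U) (bead_gaps U)" "cell U ` bead_gaps U = young U"
    using cell_bij[OF assms] by (auto simp: bij_betw_def)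
  have "mset_set (young U) = image_mset (cell U) (mset_set (bead_gaps U))"
    unfolding b(2)[symmetric] by (rule image_mset_mset_set[OF b(1), symmetric])
  then show ?thesis
    using card_hook[OF assms] assms by (auto simp: multiset.map_comp comp_def intro!: image_mset_cong)
qed

text \<open>Each hook length contributes 1 at level \<open>L\<close> exactly if \<open>p ^ L\<close>
  divides it. Reduced modulo \<open>p\<close>, the sum is the coefficient at position
  \<open>L\<close> in \<open>nim_sum\<close>.\<close>

lemma sum_digits_hook_lengths:
  assumes p: "prime p" and fin: "\<forall>l<k. finite (U l)"
  shows "(\<Sum>n\<in>#image_mset (pi_nim p) (hook_lengths (map (\<lambda>l. young (U l)) [0..<k])). digit p n L)
    = total_weight k (p ^ L) U"
proof -
  have "(\<Sum>h\<in>#image_mset (\<lambda>c. card (hook (young U) c)) (mset_set (young U)). digit p (pi_nim p h) L)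
    = weight (p ^ L) U" if fU: "finite U" for U
  proof -
    have "(\<Sum>h\<in>#image_mset (\<lambda>c. card (hook (young U) c)) (mset_set (young U)). digit p (pi_nim p h) L)
      = (\<Sum>x\<in>bead_gaps U. digit p (pi_nim p (fst x - snd x)) L)"
      unfolding hook_lengths_young[OF fU] by (simp add: multiset.map_comp comp_def sum_unfold_sum_mset)
    also have "\<dots> = (\<Sum>x\<in>bead_gaps U. of_bool (p ^ L dvd fst x - snd x))"
      by (intro sum.cong refl digit_pi_nim[OF p]) (auto simp: bead_gaps_def)
    also have "\<dots> = card {x \<in> bead_gaps U. p ^ L dvd fst x - snd x}"
      using fU by (simp add: Int_def)
    also have "\<dots> = weight (p ^ L) U"
      unfolding weight_def by (intro arg_cong[where f = card]) auto
    finally show ?thesis .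
  qed
  then have "(\<Sum>l\<leftarrow>[0..<k]. \<Sum>h\<in>#image_mset (\<lambda>c. card (hook (young (U l)) c)) (mset_set (young (U l))). digit p (pi_nim p h) L)
    = (\<Sum>l\<leftarrow>[0..<k]. weight (p ^ L) (U l))"
    using fin by (intro arg_cong[where f = sum_list] map_cong refl) auto
  also have "\<dots> = total_weight k (p ^ L) U"
    by (simp add: total_weight_def interv_sum_list_conv_sum_set_nat atLeast0LessThan)
  finally show ?thesis
    by (simp add: hook_lengths_def multiset.map_comp comp_def sum_mset_sum_list[of "\<lambda>n. digit p (pi_nim p n) L", simplified])
qed

theorem theorem4p11:
  fixes p k :: nat and Ys :: "(nat \<times> nat) set list"
  assumes "prime p"
    and "k \<ge> 1"
    and "young_tuple k Ys"
  shows "\<exists>Zs. young_tuple k Zs \<and> (\<forall>l<k. Zs ! l \<subseteq> Ys ! l) \<and>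
           tuple_size Zs = psi_nim p Ys \<and> coprime (num_standard_tableaux Zs) p"
proof -
  have p: "2 \<le> p" using assms(1) by (rule prime_ge_2_nat)
  have len: "length Ys = k" using assms(3) by (simp add: young_tuple_def)
  have "\<forall>l. l < k \<longrightarrow> (\<exists>U. finite U \<and> young U = Ys ! l)"
    using assms(3) young_diagram_obtain by (metis young_tuple_def nth_mem)
  then obtain U where U: "\<forall>l<k. finite (U l)" "\<And>l. l < k \<Longrightarrow> young (U l) = Ys ! l" by metis
  have Ys: "Ys = map (\<lambda>l. young (U l)) [0..<k]"
    using U(2) len by (intro nth_equalityI) auto
  let ?A = "{L. \<exists>n\<in>#image_mset (pi_nim p) (hook_lengths Ys). p ^ L \<le> n}"
  have psi: "psi_nim p Ys = (\<Sum>L\<in>?A. (total_weight k (p ^ L) U mod p) * p ^ L)"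
    unfolding psi_nim_def nim_sum_def using sum_digits_hook_lengths[OF assms(1) U(1)] Ys by simp
  \<comment> \<open>An upper bound is enough here, since \<open>descend\<close> reaches every
    smaller size; the positions of the digits may thus be enlarged to an initial segment.\<close>
  obtain M where M: "psi_nim p Ys \<le> (\<Sum>L<M. (total_weight k (p ^ L) U mod p) * p ^ L)"
  proof (cases "finite ?A")
    case True
    then obtain M where "?A \<subseteq> {..<M}" by (metis finite_nat_set_iff_bounded lessThan_iff subsetI)
    then have "psi_nim p Ys \<le> (\<Sum>L<M. (total_weight k (p ^ L) U mod p) * p ^ L)"
      unfolding psi by (intro sum_mono2) auto
    then show ?thesis using that by blast
  next
    \<comment> \<open>A sum over an infinite set is 0 by convention, so \<open>M = 0\<close>
      serves.\<close>
    case False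
    then have "psi_nim p Ys \<le> (\<Sum>L<0. (total_weight k (p ^ L) U mod p) * p ^ L)" unfolding psi by simp
    then show ?thesis using that by blast
  qed
  obtain V where V: "\<forall>l<k. dominated (V l) (U l)"
    "\<And>L. total_weight k (p ^ L) V = total_weight k 1 V div p ^ L"
    "(\<Sum>L<M. (total_weight k (p ^ L) U mod p) * p ^ L) \<le> total_weight k 1 V"
    using exists_p_reduced[OF p U(1), of M] by blast
  have fV: "\<forall>l<k. finite (V l)" using V(1) by (simp add: dominated_def)
  obtain W where W: "\<forall>l<k. dominated (W l) (V l)" "total_weight k 1 W = psi_nim p Ys"
    "\<not> p dvd num_tableaux k W"
    using descend[OF fV num_tableaux_coprime[OF assms(1) fV V(2)] le_trans[OF M V(3)]] by blast
  have fW: "\<forall>l<k. finite (W l)" using W(1) by (simp add: dominated_def)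
  let ?Zs = "map (\<lambda>l. young (W l)) [0..<k]"
  have "young_tuple k ?Zs" using young_diagram_young fW by (auto simp: young_tuple_def)
  moreover have "?Zs ! l \<subseteq> Ys ! l" if l: "l < k" for l
  proof -
    have "dominated (W l) (U l)" using W(1) V(1) l dominated_trans by blast
    from young_mono[OF this] show ?thesis using U(2)[OF l] l by simp
  qed
  moreover have "tuple_size ?Zs = psi_nim p Ys"
    using num_standard_tableaux_eq(1)[OF fW] W(2) by simp
  moreover have "coprime (num_standard_tableaux ?Zs) p"
    using num_standard_tableaux_eq(2)[OF fW] W(3) prime_imp_coprime[OF assms(1)]
    by (metis coprime_commute)
  ultimately show ?thesis by blast
qed

end
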